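(* Let $-\infty\le a<b\le\infty$. The regression function $y\mapsto\mathbb{E}(X_{2:2}\mid X_{2:2}^{(1)}=y)$, $y\in(a,b)$ (alternatively, $y\mapsto\mathbb{E}(X_{1:2}\mid X_{1:2}^{(1)}=y)$, $y\in(a,b)$) determines uniquely the parent distribution among absolutely continuous distributions with interval support $(a,b)$ if $(a,b)\subsetneq\mathbb{R}$; if $(a,b)=\mathbb{R}$ it determines the distribution up to a shift. That is: let $F$ and $G$ be the cumulative distribution functions of two absolutely continuous distributions with support the interval $(a,b)$, such that $X_{2:2}$ is integrable under both $F$ and $G$, and suppose that $\mathbb{E}(X_{2:2}\mid X_{2:2}^{(1)}=y)$ is the same function of $y\in(a,b)$ when the parent distribution is $F$ and when it is $G$. Then $F=G$ if $(a,b)\ne\mathbb{R}$, and there is a constant $c\in\mathbb{R}$ with $G(y)=F(y+c)$ for all $y\in\mathbb{R}$ if $(a,b)=\mathbb{R}$. The same holds with $X_{2:2}$ and $X_{2:2}^{(1)}$ replaced by $X_{1:2}$ and $X_{1:2}^{(1)}$ respectively.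
   Context: $X_1,X_2,X_3$ are independent identically distributed real random variables with the parent distribution, which is absolutely continuous with respect to Lebesgue measure. $X_{1:2}=\min(X_1,X_2)$, $X_{2:2}=\max(X_1,X_2)$, $X_{1:2}^{(1)}=\min(X_2,X_3)$, $X_{2:2}^{(1)}=\max(X_2,X_3)$. A distribution with interval support $(a,b)$ has a cumulative distribution function which is strictly increasing on $(a,b)$, with value $0$ at the left end and $1$ at the right end. The regression functions are understood as their continuous versions on $(a,b)$. *)

theory Defs
  imports "HOL-Probability.Probability"
begin

definition abs_cont_distribution :: "real measure \<Rightarrow> bool" where
  "abs_cont_distribution \<mu> \<longleftrightarrow> real_distribution \<mu> \<and> absolutely_continuous lborel \<mu>"

text \<open>At an infinite end point the corresponding boundary condition below is void: there the
  limit of a cumulative distribution function is automatically 0 (on the left) or 1 (on the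
  right).\<close>

definition interval_support :: "real measure \<Rightarrow> ereal \<Rightarrow> ereal \<Rightarrow> bool" where
  "interval_support \<mu> a b \<longleftrightarrow>
     strict_mono_on (einterval a b) (cdf \<mu>) \<and>
     (\<forall>x. ereal x = a \<longrightarrow> cdf \<mu> x = 0) \<and>
     (\<forall>x. ereal x = b \<longrightarrow> cdf \<mu> x = 1)"

definition iid_triple :: "'a measure \<Rightarrow> real measure \<Rightarrow> (nat \<Rightarrow> 'a \<Rightarrow> real) \<Rightarrow> bool" where
  "iid_triple M \<mu> X \<longleftrightarrow>
     prob_space M \<and>
     prob_space.indep_vars M (\<lambda>_. borel) X {1, 2, 3} \<and>
     (\<forall>i\<in>{1, 2, 3}. distr M borel (X i) = \<mu>)"

text \<open>\<open>r\<close> is a continuous version on \<open>I\<close> of \<open>y \<mapsto> E(U | V = y)\<close>: it is continuous on \<open>I\<close>, and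
  \<open>r(V)\<close> is a version of \<open>E(U | \<sigma>(V))\<close> where \<open>V\<close> takes values in \<open>I\<close>. It is unique on \<open>I\<close>
  whenever \<open>I\<close> is open and every nonempty open subset of \<open>I\<close> is charged by the law of \<open>V\<close>.\<close>

definition continuous_regression ::
  "'a measure \<Rightarrow> ('a \<Rightarrow> real) \<Rightarrow> ('a \<Rightarrow> real) \<Rightarrow> real set \<Rightarrow> (real \<Rightarrow> real) \<Rightarrow> bool" where
  "continuous_regression M U V I r \<longleftrightarrow>
     continuous_on I r \<and>
     (AE \<omega> in M. V \<omega> \<in> I \<longrightarrow>
        real_cond_exp M (vimage_algebra (space M) V borel) U \<omega> = r (V \<omega>))"

end

theory Submission
  imports Defs
begin

text \<open>Let \<open>F\<close> be the parent cdf. Conditioning on \<open>y < max X\<^sub>2 X\<^sub>3 \<le> z\<close> and letting \<open>z\<close> decrease to \<open>y\<close> gives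
  \<open>r y = h y - K y / (2 F y)\<close> with \<open>h y = y + (\<integral> t\<ge>y. 1 - F t)\<close> and \<open>K y = (\<integral> t<y. F t ^ 2)\<close>.
  For two solutions \<open>F\<close>, \<open>G\<close> with difference \<open>D = F - G\<close>, the functions \<open>h\<^sub>F - h\<^sub>G\<close> and
  \<open>K\<^sub>F - K\<^sub>G\<close> both vanish at the upper end point (also when it is infinite, because \<open>1 - F\<close> and
  \<open>1 - G\<close> are integrable there). Hence both are integrals over \<open>{y..}\<close> and subtracting
  the two formulas for \<open>r\<close> yields
  \<open>K\<^sub>G y / G y * D y = (\<integral> s\<ge>y. (2 F y - F s - G s) * D s)\<close>.
  The kernel is at most \<open>2 E y\<close> with \<open>E = 2 - F - G\<close> integrable at the upper end, so a Gronwall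
  argument run downwards from there gives \<open>D = 0\<close>. In particular the shift is always trivial.
  The case of minima follows by the reflection \<open>x \<mapsto> - x\<close>.\<close>

section \<open>Layer-cake formulas for truncated means, and testing a regression function\<close>

text \<open>The positive part of \<open>R - L\<close> is the length of the half-open interval from
  \<open>L\<close> to \<open>R\<close>; Tonelli exchanges this length with the expectation. Both
  tail integrals of the regression formula are instances of this identity.\<close>

lemma (in prob_space) layer_cake_difference:
  fixes L R :: "'a \<Rightarrow> real"
  assumes [measurable]: "L \<in> borel_measurable M" "R \<in> borel_measurable M"
    and int: "integrable M (\<lambda>\<omega>. max 0 (R \<omega> - L \<omega>))"
  shows "integrable lborel (\<lambda>t. prob {\<omega> \<in> space M. L \<omega> \<le> t \<and> t < R \<omega>})" (is "integrable _ ?p")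
    and "(\<integral>t. prob {\<omega> \<in> space M. L \<omega> \<le> t \<and> t < R \<omega>} \<partial>lborel) = expectation (\<lambda>\<omega>. max 0 (R \<omega> - L \<omega>))"
proof -
  interpret pair_sigma_finite M lborel ..
  have "(\<integral>\<^sup>+ t. ennreal (?p t) \<partial>lborel) = (\<integral>\<^sup>+ t. (\<integral>\<^sup>+ \<omega>. indicator {p. L (fst p) \<le> snd p \<and> snd p < R (fst p)} (\<omega>, t) \<partial>M) \<partial>lborel)"
  proof (intro nn_integral_cong)
    fix t
    have "ennreal (?p t) = emeasure M {\<omega> \<in> space M. L \<omega> \<le> t \<and> t < R \<omega>}"
      by (simp add: emeasure_eq_measure)
    also have "\<dots> = (\<integral>\<^sup>+ \<omega>. indicator {\<omega> \<in> space M. L \<omega> \<le> t \<and> t < R \<omega>} \<omega> \<partial>M)"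
      by simp
    also have "\<dots> = (\<integral>\<^sup>+ \<omega>. indicator {p. L (fst p) \<le> snd p \<and> snd p < R (fst p)} (\<omega>, t) \<partial>M)"
      by (intro nn_integral_cong) (auto simp: indicator_def)
    finally show "ennreal (?p t) = \<dots>" .
  qed
  also have "\<dots> = (\<integral>\<^sup>+ \<omega>. (\<integral>\<^sup>+ t. indicator {p. L (fst p) \<le> snd p \<and> snd p < R (fst p)} (\<omega>, t) \<partial>lborel) \<partial>M)"
    by (intro Fubini) measurable
  also have "\<dots> = (\<integral>\<^sup>+ \<omega>. ennreal (max 0 (R \<omega> - L \<omega>)) \<partial>M)"
  proof (intro nn_integral_cong)
    fix \<omega>
    have "(\<integral>\<^sup>+ t. indicator {p. L (fst p) \<le> snd p \<and> snd p < R (fst p)} (\<omega>, t) \<partial>lborel) = (\<integral>\<^sup>+ t. indicator {L \<omega>..<R \<omega>} t \<partial>lborel)"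
      by (intro nn_integral_cong) (auto simp: indicator_def)
    also have "\<dots> = ennreal (max 0 (R \<omega> - L \<omega>))"
      by (cases "L \<omega> \<le> R \<omega>") (simp_all add: max_def)
    finally show "(\<integral>\<^sup>+ t. indicator {p. L (fst p) \<le> snd p \<and> snd p < R (fst p)} (\<omega>, t) \<partial>lborel) = ennreal (max 0 (R \<omega> - L \<omega>))" .
  qed
  finally have eq: "(\<integral>\<^sup>+ t. ennreal (?p t) \<partial>lborel) = (\<integral>\<^sup>+ \<omega>. ennreal (max 0 (R \<omega> - L \<omega>)) \<partial>M)" .
  have [measurable]: "?p \<in> borel_measurable lborel"
    by measurable
  have "(\<integral>\<^sup>+ \<omega>. ennreal (max 0 (R \<omega> - L \<omega>)) \<partial>M) = ennreal (expectation (\<lambda>\<omega>. max 0 (R \<omega> - L \<omega>)))"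
    by (intro nn_integral_eq_integral int) auto
  with eq show "integrable lborel ?p"
    by (intro integrableI_nonneg) auto
  show "integral\<^sup>L lborel ?p = expectation (\<lambda>\<omega>. max 0 (R \<omega> - L \<omega>))"
    by (subst (1 2) integral_eq_nn_integral) (auto simp: eq)
qed

text \<open>The event \<open>V \<in> S\<close> lies in the sigma-algebra generated by
  \<open>V\<close>, so \<open>U\<close> may be replaced on it by its conditional expectation, which
  equals \<open>r(V)\<close> almost surely there because \<open>S\<close> is inside
  \<open>I\<close>.\<close>

lemma (in prob_space) regression_integral:
  assumes reg: "continuous_regression M U V I r" and U: "integrable M U"
    and [measurable]: "V \<in> borel_measurable M" and S: "S \<in> sets borel" "S \<subseteq> I"
  shows "expectation (\<lambda>\<omega>. indicator S (V \<omega>) * U \<omega>) = expectation (\<lambda>\<omega>. indicator S (V \<omega>) * r (V \<omega>))"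
proof -
  let ?G = "vimage_algebra (space M) V borel"
  have sub: "subalgebra M ?G"
    unfolding subalgebra_def
    by (auto simp: sets_vimage_algebra2 intro: measurable_sets)
  interpret finite_measure_subalgebra M ?G
    by unfold_locales (rule sub)
  note [measurable] = S(1)
  have cont: "continuous_on S r"
    using reg S by (auto simp: continuous_regression_def intro: continuous_on_subset)
  \<comment> \<open>Nothing is known about \<open>r\<close> off \<open>I\<close>, so measurability
    is available only after cutting \<open>r\<close> off by the indicator.\<close>
  have [measurable]: "(\<lambda>x. indicator S x * r x) \<in> borel_measurable borel"
    using borel_measurable_continuous_on_indicator[OF S(1) cont] by simp
  have A: "V -` S \<inter> space M \<in> sets ?G"
    by (rule in_vimage_algebra[OF S(1)])
  have "expectation (\<lambda>\<omega>. indicator S (V \<omega>) * U \<omega>) = (LINT \<omega>:V -` S \<inter> space M|M. U \<omega>)"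
    unfolding set_lebesgue_integral_def by (intro Bochner_Integration.integral_cong) (auto simp: indicator_def)
  also have "\<dots> = (LINT \<omega>:V -` S \<inter> space M|M. real_cond_exp M ?G U \<omega>)"
    by (rule real_cond_exp_intA[OF U A])
  also have "\<dots> = expectation (\<lambda>\<omega>. indicator S (V \<omega>) * real_cond_exp M ?G U \<omega>)"
    unfolding set_lebesgue_integral_def by (intro Bochner_Integration.integral_cong) (auto simp: indicator_def)
  also have "\<dots> = expectation (\<lambda>\<omega>. indicator S (V \<omega>) * r (V \<omega>))"
  proof (rule integral_cong_AE)
    show "(\<lambda>\<omega>. indicator S (V \<omega>) * r (V \<omega>)) \<in> borel_measurable M"
      using measurable_compose[OF \<open>V \<in> borel_measurable M\<close>, of "\<lambda>x. indicator S x * r x"] by simp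
    show "AE \<omega> in M. indicator S (V \<omega>) * real_cond_exp M ?G U \<omega> = indicator S (V \<omega>) * r (V \<omega>)"
      using reg S unfolding continuous_regression_def by (auto simp: indicator_def elim!: eventually_mono)
  qed measurable
  finally show ?thesis .
qed

text \<open>Layer cake with the constant \<open>L = y\<close> and \<open>R = X\<close>: for
  \<open>t \<ge> y\<close> the event reduces to \<open>t < X\<close>.\<close>

lemma (in prob_space) set_integrable_upper_tail:
  fixes X :: "'a \<Rightarrow> real"
  assumes [measurable]: "X \<in> borel_measurable M" and F: "\<And>t. prob {\<omega> \<in> space M. X \<omega> \<le> t} = F t"
    and int: "integrable M (\<lambda>\<omega>. max (X \<omega>) y)"
  shows "set_integrable lborel {y..} (\<lambda>t. 1 - F t)"
    and "expectation (\<lambda>\<omega>. max (X \<omega>) y) = y + (LINT t:{y..}|lborel. 1 - F t)"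
proof -
  have max_eq: "max 0 (X \<omega> - y) = max (X \<omega>) y - y" for \<omega>
    by auto
  have int': "integrable M (\<lambda>\<omega>. max 0 (X \<omega> - y))"
    unfolding max_eq using int by simp
  have p: "prob {\<omega> \<in> space M. y \<le> t \<and> t < X \<omega>} = indicator {y..} t *\<^sub>R (1 - F t)" for t
  proof (cases "y \<le> t")
    case True
    have "prob {\<omega> \<in> space M. y \<le> t \<and> t < X \<omega>} = prob {\<omega> \<in> space M. \<not> X \<omega> \<le> t}"
      using True by (intro arg_cong[where f=prob]) auto
    also have "\<dots> = 1 - F t"
      by (subst prob_neg) (auto simp: F)
    finally show ?thesis using True by simp
  qed auto
  show "set_integrable lborel {y..} (\<lambda>t. 1 - F t)"
    using layer_cake_difference(1)[of "\<lambda>_. y" X] int' unfolding p set_integrable_def by simp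
  have "expectation (\<lambda>\<omega>. max (X \<omega>) y - y) = (LINT t:{y..}|lborel. 1 - F t)"
    using layer_cake_difference(2)[of "\<lambda>_. y" X] int' unfolding p set_lebesgue_integral_def max_eq by simp
  then show "expectation (\<lambda>\<omega>. max (X \<omega>) y) = y + (LINT t:{y..}|lborel. 1 - F t)"
    using int by (simp add: prob_space)
qed

text \<open>Layer cake with \<open>L = max X Y\<close> and \<open>R = max X y\<close>. For
  \<open>t < y\<close> the condition \<open>t < R\<close> is automatic and \<open>L \<le> t\<close>
  means that both variables are at most \<open>t\<close>, whence \<open>(F t)\<^sup>2\<close>; for
  \<open>t \<ge> y\<close> the event is empty. The positive part of \<open>R - L\<close> lives on
  \<open>Y \<le> y\<close>, where it equals \<open>R - L\<close>.\<close>

lemma (in prob_space) set_integrable_square_lower_tail: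
  fixes X Y :: "'a \<Rightarrow> real"
  assumes indep: "indep_var borel X borel Y"
    and F: "\<And>t. prob {\<omega> \<in> space M. X \<omega> \<le> t} = F t" "\<And>t. prob {\<omega> \<in> space M. Y \<omega> \<le> t} = F t"
    and int: "integrable M (\<lambda>\<omega>. max (X \<omega>) y)" "integrable M (\<lambda>\<omega>. max (X \<omega>) (Y \<omega>))"
  shows "set_integrable lborel {..<y} (\<lambda>t. (F t)\<^sup>2)"
    and "expectation (\<lambda>\<omega>. indicator {..y} (Y \<omega>) * max (X \<omega>) (Y \<omega>)) =
      F y * expectation (\<lambda>\<omega>. max (X \<omega>) y) - (LINT t:{..<y}|lborel. (F t)\<^sup>2)"
proof -
  have [measurable]: "X \<in> borel_measurable M" "Y \<in> borel_measurable M"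
    using indep_var_rv1[OF indep] indep_var_rv2[OF indep] by auto
  let ?L = "\<lambda>\<omega>. max (X \<omega>) (Y \<omega>)" and ?R = "\<lambda>\<omega>. max (X \<omega>) y"
  have max_eq: "max 0 (?R \<omega> - ?L \<omega>) = indicator {..y} (Y \<omega>) * ?R \<omega> - indicator {..y} (Y \<omega>) * ?L \<omega>" for \<omega>
    by (auto simp: indicator_def max_def)
  have i1: "integrable M (\<lambda>\<omega>. indicator {..y} (Y \<omega>) * ?R \<omega>)"
    by (rule Bochner_Integration.integrable_bound[OF int(1)]) (auto simp: indicator_def)
  have i2: "integrable M (\<lambda>\<omega>. indicator {..y} (Y \<omega>) * ?L \<omega>)"
    by (rule Bochner_Integration.integrable_bound[OF int(2)]) (auto simp: indicator_def)
  have int': "integrable M (\<lambda>\<omega>. max 0 (?R \<omega> - ?L \<omega>))"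
    unfolding max_eq using i1 i2 by simp
  have p: "prob {\<omega> \<in> space M. ?L \<omega> \<le> t \<and> t < ?R \<omega>} = indicator {..<y} t *\<^sub>R (F t)\<^sup>2" for t
  proof (cases "t < y")
    case True
    have "prob {\<omega> \<in> space M. ?L \<omega> \<le> t \<and> t < ?R \<omega>} = prob (X -` {..t} \<inter> space M \<inter> (Y -` {..t} \<inter> space M))"
      using True by (intro arg_cong[where f=prob]) auto
    also have "\<dots> = prob (X -` {..t} \<inter> space M) * prob (Y -` {..t} \<inter> space M)"
      using indep_varD[OF indep, of "{..t}" "{..t}"] by (simp add: vimage_def Int_def conj_ac)
    also have "X -` {..t} \<inter> space M = {\<omega> \<in> space M. X \<omega> \<le> t}"
      by auto
    also have "Y -` {..t} \<inter> space M = {\<omega> \<in> space M. Y \<omega> \<le> t}"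
      by auto
    finally show ?thesis using True by (simp add: F power2_eq_square)
  next
    case False
    then have "{\<omega> \<in> space M. ?L \<omega> \<le> t \<and> t < ?R \<omega>} = {}"
      by auto
    then show ?thesis using False by (simp only: measure_empty) auto
  qed
  show "set_integrable lborel {..<y} (\<lambda>t. (F t)\<^sup>2)"
    using layer_cake_difference(1)[of ?L ?R] int' unfolding p set_integrable_def by simp
  have eq: "(LINT t:{..<y}|lborel. (F t)\<^sup>2) = expectation (\<lambda>\<omega>. indicator {..y} (Y \<omega>) * ?R \<omega>)
      - expectation (\<lambda>\<omega>. indicator {..y} (Y \<omega>) * ?L \<omega>)"
    using layer_cake_difference(2)[of ?L ?R] int' i1 i2 unfolding p set_lebesgue_integral_def max_eq by simp
  have "indep_var borel ((\<lambda>x. max x y) \<circ> X) borel (indicator {..y} \<circ> Y)"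
    by (rule indep_var_compose[OF indep]) auto
  then have "indep_var borel (\<lambda>\<omega>. max (X \<omega>) y) borel (\<lambda>\<omega>. indicator {..y} (Y \<omega>) :: real)"
    by (simp add: comp_def)
  from indep_var_lebesgue_integral[OF this] int(1)
  have "expectation (\<lambda>\<omega>. indicator {..y} (Y \<omega>) * ?R \<omega>) = expectation ?R * expectation (\<lambda>\<omega>. indicator {..y} (Y \<omega>))"
    by (simp add: mult.commute integrable_const_bound[where B=1])
  also have "expectation (\<lambda>\<omega>. indicator {..y} (Y \<omega>)) = expectation (indicator {\<omega> \<in> space M. Y \<omega> \<le> y})"
    by (intro Bochner_Integration.integral_cong) (auto simp: indicator_def)
  also have "\<dots> = F y"
    by (simp add: F)
  finally show "expectation (\<lambda>\<omega>. indicator {..y} (Y \<omega>) * max (X \<omega>) (Y \<omega>)) =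
      F y * expectation (\<lambda>\<omega>. max (X \<omega>) y) - (LINT t:{..<y}|lborel. (F t)\<^sup>2)"
    using eq by simp
qed

section \<open>The pointwise integral formula for the regression of maxima\<close>

lemma (in prob_space) expectation_indicator_Ioc:
  fixes X :: "'a \<Rightarrow> real"
  assumes [measurable]: "X \<in> borel_measurable M" and F: "\<And>t. prob {\<omega> \<in> space M. X \<omega> \<le> t} = F t"
    and "y \<le> z"
  shows "expectation (\<lambda>\<omega>. indicator {y<..z} (X \<omega>)) = F z - F y"
proof -
  have "expectation (\<lambda>\<omega>. indicator {y<..z} (X \<omega>)) =
      expectation (\<lambda>\<omega>. indicator {\<omega> \<in> space M. X \<omega> \<le> z} \<omega> - indicator {\<omega> \<in> space M. X \<omega> \<le> y} \<omega>)"
    using assms(3) by (intro Bochner_Integration.integral_cong) (auto simp: indicator_def)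
  also have "\<dots> = F z - F y"
    by (subst Bochner_Integration.integral_diff) (auto simp: F integrable_const_bound[where B=1])
  finally show ?thesis .
qed

lemma (in prob_space) expectation_indicator_Iic:
  fixes X :: "'a \<Rightarrow> real"
  assumes [measurable]: "X \<in> borel_measurable M" and F: "\<And>t. prob {\<omega> \<in> space M. X \<omega> \<le> t} = F t"
  shows "expectation (\<lambda>\<omega>. indicator {..z} (X \<omega>)) = F z"
proof -
  have "expectation (\<lambda>\<omega>. indicator {..z} (X \<omega>)) = expectation (indicator {\<omega> \<in> space M. X \<omega> \<le> z} :: 'a \<Rightarrow> real)"
    by (intro Bochner_Integration.integral_cong) (auto simp: indicator_def)
  then show ?thesis by (simp add: F)
qed

lemma (in prob_space) regression_max_formula:
  fixes X :: "nat \<Rightarrow> 'a \<Rightarrow> real" and F r :: "real \<Rightarrow> real"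
  defines "U \<equiv> \<lambda>\<omega>. max (X 1 \<omega>) (X 2 \<omega>)" and "V \<equiv> \<lambda>\<omega>. max (X 2 \<omega>) (X 3 \<omega>)"
  assumes indep: "indep_vars (\<lambda>_. borel) X {1, 2, 3}"
    and F: "\<And>i t. i \<in> {1, 2, 3} \<Longrightarrow> prob {\<omega> \<in> space M. X i \<omega> \<le> t} = F t"
    and contF: "continuous_on UNIV F"
    and U: "integrable M U"
    and I: "open I" "strict_mono_on I F" "continuous_on I r"
    and reg: "\<And>S. S \<in> sets borel \<Longrightarrow> S \<subseteq> I \<Longrightarrow>
      expectation (\<lambda>\<omega>. indicator S (V \<omega>) * U \<omega>) = expectation (\<lambda>\<omega>. indicator S (V \<omega>) * r (V \<omega>))"
  shows "\<And>y. set_integrable lborel {y..} (\<lambda>t. 1 - F t)"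
    and "\<And>y. set_integrable lborel {..<y} (\<lambda>t. (F t)\<^sup>2)"
    and "\<And>y. y \<in> I \<Longrightarrow>
      2 * F y * r y = 2 * F y * (y + (LINT t:{y..}|lborel. 1 - F t)) - (LINT t:{..<y}|lborel. (F t)\<^sup>2)"
proof -
  have mX [measurable]: "X 1 \<in> borel_measurable M" "X 2 \<in> borel_measurable M" "X 3 \<in> borel_measurable M"
    using indep unfolding indep_vars_def by auto
  have UV [measurable]: "U \<in> borel_measurable M" "V \<in> borel_measurable M"
    unfolding U_def V_def by measurable
  have F1: "\<And>t. prob {\<omega> \<in> space M. X 1 \<omega> \<le> t} = F t" and F2: "\<And>t. prob {\<omega> \<in> space M. X 2 \<omega> \<le> t} = F t"
    and F3: "\<And>t. prob {\<omega> \<in> space M. X 3 \<omega> \<le> t} = F t"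
    using F by auto
  have ind12: "indep_var borel (X 1) borel (X 2)"
    using indep_var_compose[OF indep_var_restrict[OF indep, of "{1}" "{2}"], of "\<lambda>x. x 1" borel "\<lambda>x. x 2" borel]
    by (simp add: comp_def)
  have ind12_3: "indep_var borel (\<lambda>\<omega>. f (X 1 \<omega>) (X 2 \<omega>)) borel (\<lambda>\<omega>. g (X 3 \<omega>))"
    if [measurable]: "(\<lambda>p. f (fst p) (snd p)) \<in> borel_measurable (borel \<Otimes>\<^sub>M borel)" "g \<in> borel_measurable borel"
    for f :: "real \<Rightarrow> real \<Rightarrow> real" and g :: "real \<Rightarrow> real"
  proof -
    have "(\<lambda>x. (x 1, x 2)) \<in> measurable (Pi\<^sub>M {1, 2::nat} (\<lambda>_. borel)) (borel \<Otimes>\<^sub>M borel :: (real \<times> real) measure)"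
      by measurable
    from measurable_compose[OF this that(1)]
    have m1: "(\<lambda>x. f (x 1) (x 2)) \<in> borel_measurable (Pi\<^sub>M {1, 2::nat} (\<lambda>_. borel))"
      by simp
    have m2: "(\<lambda>x. g (x 3)) \<in> borel_measurable (Pi\<^sub>M {3::nat} (\<lambda>_. borel))"
      by measurable
    have "indep_var borel ((\<lambda>x. f (x 1) (x 2)) \<circ> (\<lambda>\<omega>. restrict (\<lambda>i. X i \<omega>) {1, 2}))
       borel ((\<lambda>x. g (x 3)) \<circ> (\<lambda>\<omega>. restrict (\<lambda>i. X i \<omega>) {3}))"
      by (rule indep_var_compose[OF indep_var_restrict[OF indep] m1 m2]) auto
    then show ?thesis
      by (simp add: comp_def)
  qed
  have max_int: "integrable M (\<lambda>\<omega>. max (X 1 \<omega>) y)" for y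
  proof (rule Bochner_Integration.integrable_bound)
    show "integrable M (\<lambda>\<omega>. \<bar>U \<omega>\<bar> + \<bar>y\<bar>)"
      using U by auto
    show "AE \<omega> in M. norm (max (X 1 \<omega>) y) \<le> norm (\<bar>U \<omega>\<bar> + \<bar>y\<bar>)"
      by (intro AE_I2) (auto simp: U_def max_def)
  qed measurable
  show tail: "set_integrable lborel {y..} (\<lambda>t. 1 - F t)" for y
    using set_integrable_upper_tail(1)[OF mX(1) F1 max_int] .
  show "set_integrable lborel {..<y} (\<lambda>t. (F t)\<^sup>2)" for y
    using set_integrable_square_lower_tail(1)[OF ind12 F1 F2 max_int U[unfolded U_def]] .
  fix y assume y: "y \<in> I"
  \<comment> \<open>Heuristically, given that \<open>V\<close> is near \<open>y\<close>, either
    \<open>X 2\<close> is near \<open>y\<close> and \<open>U\<close> has mean \<open>h y\<close>, or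
    \<open>X 3\<close> is near \<open>y\<close> with \<open>X 2\<close> below it, which contributes
    \<open>H\<close>.\<close>
  define h where "h = (\<lambda>y. expectation (\<lambda>\<omega>. max (X 1 \<omega>) y))"
  define H where "H = expectation (\<lambda>\<omega>. indicator {..y} (X 2 \<omega>) * U \<omega>)"
  have h: "h y = y + (LINT t:{y..}|lborel. 1 - F t)"
    unfolding h_def using set_integrable_upper_tail(2)[OF mX(1) F1 max_int] .
  have H: "H = F y * h y - (LINT t:{..<y}|lborel. (F t)\<^sup>2)"
    unfolding H_def h_def U_def
    using set_integrable_square_lower_tail(2)[OF ind12 F1 F2 max_int U[unfolded U_def]] .
  have bint: "integrable M (\<lambda>\<omega>. indicator S (f \<omega>) :: real)" if [measurable]: "f \<in> borel_measurable M" "S \<in> sets borel"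
    for f :: "'a \<Rightarrow> real" and S
    by (rule integrable_const_bound[where B=1]) auto
  have bintU: "integrable M (\<lambda>\<omega>. indicator S (X 2 \<omega>) * U \<omega>)" if [measurable]: "S \<in> sets borel" for S
    by (rule Bochner_Integration.integrable_bound[OF U]) (auto simp: indicator_def)
  \<comment> \<open>\<open>V\<close> crosses the window either through \<open>X 2\<close>, or through \<open>X 3\<close> alone.\<close>
  have ind_eq: "indicator {y<..z} (V \<omega>) =
     (indicator {y<..z} (X 2 \<omega>) * indicator {..z} (X 3 \<omega>) + indicator {..y} (X 2 \<omega>) * indicator {y<..z} (X 3 \<omega>) :: real)"
    if "y < z" for z \<omega>
    using that by (auto simp: V_def indicator_def max_def)

  \<comment> \<open>\<open>m\<close> and \<open>m'\<close> bound \<open>r\<close> on the window.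
    When \<open>X 2\<close> is in \<open>{y<..z}\<close>, \<open>U\<close> lies between
    \<open>max (X 1) y\<close> and \<open>max (X 1) z\<close>, and these differ by at most
    \<open>z - y\<close>; this accounts for the gap between the two estimates.\<close>
  have key: "m * (F z + F y) \<le> F z * (h y + (z - y)) + H \<and> F z * h y + H \<le> m' * (F z + F y)"
    if z: "y < z" "{y..z} \<subseteq> I" and m: "\<And>t. y < t \<Longrightarrow> t \<le> z \<Longrightarrow> m \<le> r t" and m': "\<And>t. y < t \<Longrightarrow> t \<le> z \<Longrightarrow> r t \<le> m'" for z m m'
  proof -
    have sub: "{y<..z} \<subseteq> I"
      using z by (auto simp: subset_iff)
    define \<Delta> where "\<Delta> = F z - F y"
    have \<Delta>: "\<Delta> > 0"
      using strict_mono_onD[OF I(2) y _ z(1)] z by (auto simp: \<Delta>_def subset_iff)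
    define A where "A = expectation (\<lambda>\<omega>. indicator {y<..z} (X 2 \<omega>) * U \<omega>)"
    have ex12: "expectation (\<lambda>\<omega>. indicator {y<..z} (X 2 \<omega>) * max (X 1 \<omega>) c) = \<Delta> * h c"
      and ex12i: "integrable M (\<lambda>\<omega>. indicator {y<..z} (X 2 \<omega>) * max (X 1 \<omega>) c)" for c
    proof -
      have "indep_var borel ((\<lambda>x. max x c) \<circ> X 1) borel (indicator {y<..z} \<circ> X 2)"
        by (rule indep_var_compose[OF ind12]) auto
      then have iv: "indep_var borel (\<lambda>\<omega>. max (X 1 \<omega>) c) borel (\<lambda>\<omega>. indicator {y<..z} (X 2 \<omega>) :: real)"
        by (simp add: comp_def)
      show "expectation (\<lambda>\<omega>. indicator {y<..z} (X 2 \<omega>) * max (X 1 \<omega>) c) = \<Delta> * h c"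
        using indep_var_lebesgue_integral[OF iv max_int bint] expectation_indicator_Ioc[OF mX(2) F2, of y z] z
        by (simp add: mult.commute h_def \<Delta>_def)
      show "integrable M (\<lambda>\<omega>. indicator {y<..z} (X 2 \<omega>) * max (X 1 \<omega>) c)"
        using indep_var_integrable[OF iv max_int bint] by (simp add: mult.commute)
    qed
    have A1: "\<Delta> * h y \<le> A"
      unfolding A_def ex12[symmetric]
      by (rule integral_mono[OF ex12i bintU]) (auto simp: indicator_def U_def)
    have "A \<le> \<Delta> * h z"
      unfolding A_def ex12[symmetric]
      by (rule integral_mono[OF bintU ex12i]) (auto simp: indicator_def U_def)
    moreover have "h z \<le> expectation (\<lambda>\<omega>. max (X 1 \<omega>) y + (z - y))"
      unfolding h_def by (rule integral_mono) (use z max_int in auto)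
    then have "h z \<le> h y + (z - y)"
      using max_int by (simp add: h_def prob_space)
    ultimately have A2: "A \<le> \<Delta> * (h y + (z - y))"
      using \<Delta> by (meson less_imp_le mult_left_mono order_trans)
    have ex3: "expectation (\<lambda>\<omega>. indicator S (X 2 \<omega>) * U \<omega> * indicator T (X 3 \<omega>)) =
        expectation (\<lambda>\<omega>. indicator S (X 2 \<omega>) * U \<omega>) * expectation (\<lambda>\<omega>. indicator T (X 3 \<omega>))"
      and ex3i: "integrable M (\<lambda>\<omega>. indicator S (X 2 \<omega>) * U \<omega> * indicator T (X 3 \<omega>))"
      and ey3: "expectation (\<lambda>\<omega>. indicator S (X 2 \<omega>) * indicator T (X 3 \<omega>) :: real) =
        expectation (\<lambda>\<omega>. indicator S (X 2 \<omega>)) * expectation (\<lambda>\<omega>. indicator T (X 3 \<omega>))"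
      and ey3i: "integrable M (\<lambda>\<omega>. indicator S (X 2 \<omega>) * indicator T (X 3 \<omega>) :: real)"
      if [measurable]: "S \<in> sets borel" "T \<in> sets borel" for S T
    proof -
      have iv: "indep_var borel (\<lambda>\<omega>. indicator S (X 2 \<omega>) * U \<omega>) borel (\<lambda>\<omega>. indicator T (X 3 \<omega>) :: real)"
        unfolding U_def by (rule ind12_3) measurable
      have iv': "indep_var borel (\<lambda>\<omega>. indicator S (X 2 \<omega>)) borel (\<lambda>\<omega>. indicator T (X 3 \<omega>) :: real)"
        using ind12_3[of "\<lambda>x y. indicator S y" "indicator T"] by simp
      note * = bint[of "X 3" T, OF _ that(2)] bint[of "X 2" S, OF _ that(1)] bintU[OF that(1)]
      show "expectation (\<lambda>\<omega>. indicator S (X 2 \<omega>) * U \<omega> * indicator T (X 3 \<omega>)) =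
        expectation (\<lambda>\<omega>. indicator S (X 2 \<omega>) * U \<omega>) * expectation (\<lambda>\<omega>. indicator T (X 3 \<omega>))"
        using indep_var_lebesgue_integral[OF iv] * by simp
      show "integrable M (\<lambda>\<omega>. indicator S (X 2 \<omega>) * U \<omega> * indicator T (X 3 \<omega>))"
        using indep_var_integrable[OF iv] * by simp
      show "expectation (\<lambda>\<omega>. indicator S (X 2 \<omega>) * indicator T (X 3 \<omega>) :: real) =
        expectation (\<lambda>\<omega>. indicator S (X 2 \<omega>)) * expectation (\<lambda>\<omega>. indicator T (X 3 \<omega>))"
        using indep_var_lebesgue_integral[OF iv'] * by simp
      show "integrable M (\<lambda>\<omega>. indicator S (X 2 \<omega>) * indicator T (X 3 \<omega>) :: real)"
        using indep_var_integrable[OF iv'] * by simp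
    qed
    note E = expectation_indicator_Ioc[OF mX(2) F2, of y z] expectation_indicator_Iic[OF mX(2) F2, of y]
      expectation_indicator_Ioc[OF mX(3) F3, of y z] expectation_indicator_Iic[OF mX(3) F3, of z]
    \<comment> \<open>Each of the two ways of entering the window factors, since \<open>X 3\<close>
      is independent of the pair formed by \<open>X 1\<close> and \<open>X 2\<close>.\<close>
    have "expectation (\<lambda>\<omega>. indicator {y<..z} (V \<omega>) * U \<omega>) =
       expectation (\<lambda>\<omega>. indicator {y<..z} (X 2 \<omega>) * U \<omega> * indicator {..z} (X 3 \<omega>) + indicator {..y} (X 2 \<omega>) * U \<omega> * indicator {y<..z} (X 3 \<omega>))"
      by (intro Bochner_Integration.integral_cong) (auto simp: ind_eq[OF z(1)] algebra_simps)
    also have "\<dots> = A * F z + H * \<Delta>"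
      using E z by (subst Bochner_Integration.integral_add) (auto simp: ex3i ex3 A_def H_def \<Delta>_def)
    finally have EU: "expectation (\<lambda>\<omega>. indicator {y<..z} (V \<omega>) * r (V \<omega>)) = A * F z + H * \<Delta>"
      using reg[of "{y<..z}"] sub by simp
    have "expectation (\<lambda>\<omega>. indicator {y<..z} (V \<omega>) :: real) =
       expectation (\<lambda>\<omega>. indicator {y<..z} (X 2 \<omega>) * indicator {..z} (X 3 \<omega>) + indicator {..y} (X 2 \<omega>) * indicator {y<..z} (X 3 \<omega>))"
      by (intro Bochner_Integration.integral_cong) (auto simp: ind_eq[OF z(1)] algebra_simps)
    also have "\<dots> = \<Delta> * F z + F y * \<Delta>"
      using E z by (subst Bochner_Integration.integral_add) (auto simp: ey3i ey3 \<Delta>_def)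
    also have "\<dots> = \<Delta> * (F z + F y)"
      by (simp add: algebra_simps)
    finally have EV: "expectation (\<lambda>\<omega>. indicator {y<..z} (V \<omega>)) = \<Delta> * (F z + F y)" .
    have cont: "continuous_on {y<..z} r"
      by (rule continuous_on_subset[OF I(3) sub])
    have [measurable]: "(\<lambda>x. indicator {y<..z} x * r x) \<in> borel_measurable borel"
      using borel_measurable_continuous_on_indicator[OF _ cont] by simp
    have mr: "(\<lambda>\<omega>. indicator {y<..z} (V \<omega>) * r (V \<omega>)) \<in> borel_measurable M"
      using measurable_compose[OF UV(2), of "\<lambda>x. indicator {y<..z} x * r x"] by simp
    \<comment> \<open>Integrability of \<open>r(V)\<close> comes from the bounds \<open>m\<close>
      and \<open>m'\<close> on the window alone.\<close>
    have ri: "integrable M (\<lambda>\<omega>. indicator {y<..z} (V \<omega>) * r (V \<omega>))"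
    proof (rule integrable_const_bound[OF AE_I2 mr, where B="max \<bar>m\<bar> \<bar>m'\<bar>"])
      fix \<omega>
      show "norm (indicator {y<..z} (V \<omega>) * r (V \<omega>)) \<le> max \<bar>m\<bar> \<bar>m'\<bar>"
      proof (cases "V \<omega> \<in> {y<..z}")
        case True
        then show ?thesis using m[of "V \<omega>"] m'[of "V \<omega>"] by auto
      qed auto
    qed
    have ci: "integrable M (\<lambda>\<omega>. c * indicator {y<..z} (V \<omega>) :: real)" for c
      using bint[OF UV(2), of "{y<..z}"] by simp
    have "expectation (\<lambda>\<omega>. m * indicator {y<..z} (V \<omega>)) \<le> expectation (\<lambda>\<omega>. indicator {y<..z} (V \<omega>) * r (V \<omega>))"
      by (rule integral_mono[OF ci ri]) (auto simp: indicator_def m)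
    then have 1: "m * (\<Delta> * (F z + F y)) \<le> A * F z + H * \<Delta>"
      by (simp add: EU EV)
    have "expectation (\<lambda>\<omega>. indicator {y<..z} (V \<omega>) * r (V \<omega>)) \<le> expectation (\<lambda>\<omega>. m' * indicator {y<..z} (V \<omega>))"
      by (rule integral_mono[OF ri ci]) (auto simp: indicator_def m')
    then have 2: "A * F z + H * \<Delta> \<le> m' * (\<Delta> * (F z + F y))"
      by (simp add: EU EV)
    have Fz: "F z \<ge> 0"
      by (subst F1[symmetric]) simp
    have "m * (\<Delta> * (F z + F y)) \<le> \<Delta> * (h y + (z - y)) * F z + H * \<Delta>"
      using 1 mult_right_mono[OF A2 Fz] by linarith
    then have "\<Delta> * (m * (F z + F y)) \<le> \<Delta> * (F z * (h y + (z - y)) + H)"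
      by (simp add: algebra_simps)
    moreover have "\<Delta> * h y * F z + H * \<Delta> \<le> m' * (\<Delta> * (F z + F y))"
      using 2 mult_right_mono[OF A1 Fz] by linarith
    then have "\<Delta> * (F z * h y + H) \<le> \<Delta> * (m' * (F z + F y))"
      by (simp add: algebra_simps)
    ultimately show ?thesis
      using \<Delta> by (simp only: mult_le_cancel_left_pos)
  qed

  have Flim: "(F \<longlongrightarrow> F y) (at_right y)"
    using contF by (meson UNIV_I continuous_on_def filterlim_at_split tendsto_within_subset continuous_on_eq_continuous_at isCont_def open_UNIV)
  \<comment> \<open>Since \<open>I\<close> is open and \<open>r\<close> is continuous at
    \<open>y\<close>, the bounds in \<open>key\<close> can be taken as \<open>r y - e\<close> and
    \<open>r y + e\<close> once \<open>z\<close> is close enough to \<open>y\<close>.\<close>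
  have rI: "\<forall>\<^sub>F z in at_right y. (r y - e) * (F z + F y) \<le> F z * (h y + (z - y)) + H \<and> F z * h y + H \<le> (r y + e) * (F z + F y)"
    if e: "e > 0" for e
  proof -
    obtain d1 where d1: "d1 > 0" "\<And>t. dist t y < d1 \<Longrightarrow> t \<in> I"
      using I(1) y by (auto simp: open_dist)
    obtain d2 where d2: "d2 > 0" "\<And>t. t \<in> I \<Longrightarrow> dist t y < d2 \<Longrightarrow> dist (r t) (r y) < e"
      using I(3)[unfolded continuous_on_iff, rule_format, OF y e] by blast
    have "\<forall>\<^sub>F z in at_right y. z \<in> {y<..<y + min d1 d2}"
      using d1 d2 by (intro eventually_at_right_real) auto
    then show ?thesis
    proof eventually_elim
      case (elim z)
      have dist: "dist t y < min d1 d2" if "y \<le> t" "t \<le> z" for t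
        using elim that by (auto simp: dist_real_def min_def split: if_splits)
      have sub: "{y..z} \<subseteq> I"
        using d1(2) dist by (meson atLeastAtMost_iff min_less_iff_conj subsetI)
      have "\<bar>r t - r y\<bar> < e" if "y < t" "t \<le> z" for t
        using d2(2)[of t] sub dist[of t] that by (auto simp: dist_real_def subset_iff)
      then have "r y - e \<le> r t" "r t \<le> r y + e" if "y < t" "t \<le> z" for t
        using that by (fastforce simp: abs_less_iff)+
      then show ?case
        using elim sub by (intro key) auto
    qed
  qed
  have lim0: "((\<lambda>z. z - y) \<longlongrightarrow> 0) (at_right y)"
    by (auto intro!: tendsto_eq_intros)
  \<comment> \<open>Two limits in succession: first \<open>z\<close> decreases to \<open>y\<close>
    with \<open>e\<close> fixed, then \<open>e\<close> decreases to 0.\<close>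
  have "(r y - e) * (F y + F y) \<le> F y * h y + H \<and> F y * h y + H \<le> (r y + e) * (F y + F y)" if "e > 0" for e
  proof
    have "((\<lambda>z. (r y - e) * (F z + F y)) \<longlongrightarrow> (r y - e) * (F y + F y)) (at_right y)"
      by (intro tendsto_intros Flim)
    moreover have "((\<lambda>z. F z * (h y + (z - y)) + H) \<longlongrightarrow> F y * (h y + 0) + H) (at_right y)"
      by (intro tendsto_intros Flim lim0)
    ultimately show "(r y - e) * (F y + F y) \<le> F y * h y + H"
      using tendsto_le[OF trivial_limit_at_right_real] eventually_conj_iff[THEN iffD1, OF rI[OF that]] by fastforce
    have "((\<lambda>z. (r y + e) * (F z + F y)) \<longlongrightarrow> (r y + e) * (F y + F y)) (at_right y)"
      by (intro tendsto_intros Flim)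
    moreover have "((\<lambda>z. F z * h y + H) \<longlongrightarrow> F y * h y + H) (at_right y)"
      by (intro tendsto_intros Flim)
    ultimately show "F y * h y + H \<le> (r y + e) * (F y + F y)"
      using tendsto_le[OF trivial_limit_at_right_real] eventually_conj_iff[THEN iffD1, OF rI[OF that]] by fastforce
  qed note le = this
  \<comment> \<open>The coefficient \<open>c\<close> serves both bounds: it is -1 for the lower and
    1 for the upper one.\<close>
  have lim_e: "((\<lambda>e::real. (r y + c * e) * (F y + F y)) \<longlongrightarrow> (r y + c * 0) * (F y + F y)) (at_right 0)" for c
    by (intro tendsto_intros) 
  have pos: "\<forall>\<^sub>F e::real in at_right 0. e > 0"
    by (simp add: eventually_at_right_less)
  have "(r y + (-1) * 0) * (F y + F y) \<le> F y * h y + H"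
    by (rule tendsto_upperbound[OF lim_e]) (use pos le in \<open>auto elim!: eventually_mono\<close>)
  moreover have "F y * h y + H \<le> (r y + 1 * 0) * (F y + F y)"
    by (rule tendsto_lowerbound[OF lim_e]) (use pos le in \<open>auto elim!: eventually_mono\<close>)
  ultimately have "(r y) * (F y + F y) = F y * h y + H"
    by simp
  then show "2 * F y * r y = 2 * F y * (y + (LINT t:{y..}|lborel. 1 - F t)) - (LINT t:{..<y}|lborel. (F t)\<^sup>2)"
    using H h by (simp add: algebra_simps)
qed

section \<open>Integrals over half-lines and a Gronwall argument from the upper end\<close>

lemma set_integral_split_Ici:
  fixes f :: "real \<Rightarrow> real"
  assumes "set_integrable lborel {y..} f" "y \<le> z"
  shows "(LINT t:{y..}|lborel. f t) = (LINT t:{y..<z}|lborel. f t) + (LINT t:{z..}|lborel. f t)"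
proof -
  have eq: "{y..} = {y..<z} \<union> {z..}"
    using assms by auto
  show ?thesis
    unfolding eq by (intro set_integral_Un set_integrable_subset[OF assms(1)]) (use assms(2) in auto)
qed

lemma set_integral_split_Iio:
  fixes f :: "real \<Rightarrow> real"
  assumes "set_integrable lborel {..<z} f" "y \<le> z"
  shows "(LINT t:{..<z}|lborel. f t) = (LINT t:{..<y}|lborel. f t) + (LINT t:{y..<z}|lborel. f t)"
proof -
  have eq: "{..<z} = {..<y} \<union> {y..<z}"
    using assms by auto
  show ?thesis
    unfolding eq by (intro set_integral_Un set_integrable_subset[OF assms(1)]) (use assms(2) in auto)
qed

lemma set_integral_const_Ico:
  fixes c :: real
  assumes "y \<le> z"
  shows "(LINT t:{y..<z}|lborel. c) = c * (z - y)" and "set_integrable lborel {y..<z} (\<lambda>t. c)"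
  using assms by (simp_all add: set_lebesgue_integral_def set_integrable_def)

lemma set_integral_bounds_Ico:
  fixes f :: "real \<Rightarrow> real"
  assumes "set_integrable lborel {y..<z} f" "y \<le> z"
  shows "(\<And>t. y \<le> t \<Longrightarrow> t < z \<Longrightarrow> f t \<le> c) \<Longrightarrow> (LINT t:{y..<z}|lborel. f t) \<le> c * (z - y)"
    and "(\<And>t. y \<le> t \<Longrightarrow> t < z \<Longrightarrow> c \<le> f t) \<Longrightarrow> c * (z - y) \<le> (LINT t:{y..<z}|lborel. f t)"
  unfolding set_integral_const_Ico(1)[OF assms(2), symmetric]
  by (intro set_integral_mono set_integral_const_Ico assms; simp)+

lemma set_integral_nonneg_Lebesgue:
  fixes f :: "real \<Rightarrow> real"
  assumes "\<And>t. t \<in> A \<Longrightarrow> 0 \<le> f t"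
  shows "0 \<le> (LINT t:A|lborel. f t)"
  unfolding set_lebesgue_integral_def using assms
  by (intro Bochner_Integration.integral_nonneg) (auto simp: indicator_def)

text \<open>Gronwall in integrated form for the tail integral \<open>\<Phi>\<close> of
  \<open>\<bar>d\<bar>\<close>. Beyond \<open>z\<close> the small integral of \<open>E\<close> makes
  the inequality a contraction, so \<open>\<Phi> z = 0\<close>; below \<open>z\<close> boundedness
  of \<open>E\<close> gives a contraction on short intervals.\<close>

lemma tail_integral_eq_0:
  fixes d E :: "real \<Rightarrow> real"
  assumes d: "set_integrable lborel {y0..} (\<lambda>t. \<bar>d t\<bar>)" and E: "set_integrable lborel {y0..} E"
    and E_bd: "\<And>t. 0 \<le> E t" "\<And>t. E t \<le> B" and c: "c > 0"
    and le: "\<And>y. y0 \<le> y \<Longrightarrow> \<bar>d y\<bar> \<le> c * E y * (LINT t:{y..}|lborel. \<bar>d t\<bar>)"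
    and z: "y0 \<le> z" "(LINT t:{z..}|lborel. E t) < 1 / c"
  shows "(LINT t:{y0..}|lborel. \<bar>d t\<bar>) = 0"
proof -
  define \<Phi> where "\<Phi> = (\<lambda>y. LINT t:{y..}|lborel. \<bar>d t\<bar>)"
  have d': "set_integrable lborel S (\<lambda>t. \<bar>d t\<bar>)" if "S \<subseteq> {y0..}" "S \<in> sets borel" for S
    by (rule set_integrable_subset[OF d]) (use that in auto)
  have E': "set_integrable lborel S E" if "S \<subseteq> {y0..}" "S \<in> sets borel" for S
    by (rule set_integrable_subset[OF E]) (use that in auto)
  have \<Phi>_nonneg: "\<Phi> y \<ge> 0" for y
    unfolding \<Phi>_def by (rule set_integral_nonneg_Lebesgue) auto
  have split: "\<Phi> y = (LINT t:{y..<x}|lborel. \<bar>d t\<bar>) + \<Phi> x" if "y0 \<le> y" "y \<le> x" for y x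
    unfolding \<Phi>_def by (rule set_integral_split_Ici) (use that d' in auto)
  have anti: "\<Phi> x \<le> \<Phi> y" if "y0 \<le> y" "y \<le> x" for y x
    using split[OF that] set_integral_nonneg_Lebesgue[of "{y..<x}" "\<lambda>t. \<bar>d t\<bar>"] by simp
  have zero_z: "\<Phi> z = 0"
  proof -
    \<comment> \<open>As \<open>\<Phi>\<close> is nonincreasing, \<open>\<Phi> t\<close> is replaced
      by \<open>\<Phi> z\<close> under the integral, which gives
      \<open>\<Phi> z \<le> \<theta> * \<Phi> z\<close> with \<theta> = c times the integral of
      \<open>E\<close> over \<open>{z..}\<close>, less than 1.\<close>
    have "\<Phi> z \<le> (LINT t:{z..}|lborel. (c * \<Phi> z) * E t)"
      unfolding \<Phi>_def[THEN fun_cong, of z]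
    proof (rule set_integral_mono)
      fix t assume "t \<in> {z..}"
      then have t: "z \<le> t" "y0 \<le> t" using z by auto
      have "\<bar>d t\<bar> \<le> c * E t * \<Phi> t"
        using le[OF t(2)] by (simp add: \<Phi>_def)
      also have "\<dots> \<le> c * E t * \<Phi> z"
        by (intro mult_left_mono anti) (use t z E_bd c in auto)
      finally show "\<bar>d t\<bar> \<le> c * (LINT t:{z..}|lborel. \<bar>d t\<bar>) * E t"
        by (simp add: \<Phi>_def mult_ac)
    qed (use z d' E' in auto)
    then have "\<Phi> z \<le> \<Phi> z * (c * (LINT t:{z..}|lborel. E t))"
      by (simp add: mult_ac)
    moreover have "c * (LINT t:{z..}|lborel. E t) < 1"
      using z c by (simp add: field_simps)
    ultimately show ?thesis
      using \<Phi>_nonneg[of z] by (smt (verit) mult_less_cancel_left2)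
  qed
  have "B \<ge> 0" using E_bd[of 0] by linarith
  \<comment> \<open>With this step length \<open>c * B * s = B / (B + 1) < 1\<close>; the added 1
    covers \<open>B = 0\<close>.\<close>
  define s where "s = 1 / (c * (B + 1))"
  have "c * B * s = B / (B + 1)"
    using c by (simp add: s_def)
  then have s: "s > 0" "c * B * s < 1"
    using c \<open>B \<ge> 0\<close> by (auto simp: s_def)
  \<comment> \<open>Vanishing propagates downwards in steps of the fixed length \<open>s\<close>.\<close>
  have step: "\<Phi> y = 0" if y: "y0 \<le> y" "y \<le> x" "x \<le> y + s" and "\<Phi> x = 0" for y x
  proof -
    have "\<Phi> y = (LINT t:{y..<x}|lborel. \<bar>d t\<bar>)"
      using split[OF y(1,2)] that by simp
    also have "\<dots> \<le> (c * B * \<Phi> y) * (x - y)"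
    proof (rule set_integral_bounds_Ico(1))
      fix t assume t: "y \<le> t" "t < x"
      have "\<bar>d t\<bar> \<le> c * E t * \<Phi> t"
        using le[of t] t y by (simp add: \<Phi>_def)
      also have "\<dots> \<le> c * B * \<Phi> y"
        using E_bd c t y anti[of y t] \<Phi>_nonneg \<open>B \<ge> 0\<close> by (intro mult_mono) auto
      finally show "\<bar>d t\<bar> \<le> c * B * \<Phi> y" .
    qed (use y in \<open>auto intro!: d'\<close>)
    also have "\<dots> \<le> (c * B * \<Phi> y) * s"
      using y c \<open>B \<ge> 0\<close> \<Phi>_nonneg by (intro mult_left_mono) auto
    finally have "\<Phi> y \<le> \<Phi> y * (c * B * s)" by (simp add: mult_ac)
    then show ?thesis
      using \<Phi>_nonneg[of y] s by (smt (verit) mult_less_cancel_left2)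
  qed
  \<comment> \<open>Truncation at \<open>y0\<close> keeps every point in the range where the
    inequality is assumed, and the descent reaches \<open>y0\<close> after finitely many
    steps.\<close>
  have "\<Phi> (max y0 (z - real n * s)) = 0" for n
  proof (induction n)
    case 0
    then show ?case using z zero_z by simp
  next
    case (Suc n)
    show ?case
      by (rule step[OF _ _ _ Suc]) (use s in \<open>auto simp: algebra_simps max_def\<close>)
  qed
  moreover obtain n where "(z - y0) / s \<le> real n"
    using real_arch_simple by blast
  then have "max y0 (z - real n * s) = y0"
    using s by (auto simp: field_simps)
  ultimately show ?thesis
    unfolding \<Phi>_def by metis
qed

text \<open>The point \<open>z\<close> has to stay inside the interval because the regression
  equation is only available there. The bound on \<open>(z - y) * E z\<close> holds for a monotone
  integrable tail, as \<open>(z - w) * E z\<close> is at most the integral of \<open>E\<close> from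
  \<open>w\<close> to \<open>z\<close>; it will absorb a term growing linearly in
  \<open>z\<close>.\<close>

lemma exists_near_upper_end:
  fixes E :: "real \<Rightarrow> real" and a b :: ereal
  assumes y: "y \<in> einterval a b"
    and anti: "antimono E" and nonneg: "\<And>t. 0 \<le> E t"
    and cont: "continuous_on UNIV E" and lim: "(E \<longlongrightarrow> 0) at_top"
    and zero: "\<And>t. b \<le> ereal t \<Longrightarrow> E t = 0"
    and int: "\<And>y. set_integrable lborel {y..} E" and "e > 0"
  obtains z where "z \<in> einterval a b" "y \<le> z" "(LINT t:{z..}|lborel. E t) < e" "E z < e" "(z - y) * E z < e"
proof -
  have "ereal y < b" using y by (simp add: einterval_def)
  \<comment> \<open>A sequence increasing to \<open>b\<close> treats finite and infinite
    \<open>b\<close> together.\<close>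
  then obtain Z :: "nat \<Rightarrow> real" where Z: "incseq Z" "\<And>n. ereal y < Z n" "\<And>n. Z n < b" "(\<lambda>n. ereal (Z n)) \<longlonglongrightarrow> b"
    by (rule ereal_incseq_approx) blast
  have ZI: "Z n \<in> einterval a b" "y \<le> Z n" for n
    using Z(2,3)[of n] y by (auto simp: einterval_def intro: less_trans)
  have EZ: "(\<lambda>n. E (Z n)) \<longlonglongrightarrow> 0"
  proof (cases b)
    case (real b')
    then have "Z \<longlonglongrightarrow> b'" using Z(4) by simp
    then have "(\<lambda>n. E (Z n)) \<longlonglongrightarrow> E b'"
      by (intro continuous_on_tendsto_compose[OF cont]) auto
    then show ?thesis using zero[of b'] real by simp
  next
    case PInf
    then have "filterlim Z at_top sequentially" using Z(4) by (simp add: tendsto_PInfty_eq_at_top)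
    then show ?thesis by (rule filterlim_compose[OF lim])
  next
    case MInf
    then show ?thesis using Z(3)[of 0] by simp
  qed
  define P where "P = (\<lambda>z. LINT t:{z..}|lborel. E t)"
  \<comment> \<open>Dominated convergence: at each \<open>t\<close>, either \<open>t\<close> is at
    or beyond \<open>b\<close> and \<open>E t = 0\<close>, or \<open>t\<close> is eventually to the
    left of \<open>Z n\<close>.\<close>
  have PZ: "(\<lambda>n. P (Z n)) \<longlonglongrightarrow> 0"
  proof -
    have "(\<lambda>n. LINT t|lborel. indicator {Z n..} t *\<^sub>R E t) \<longlonglongrightarrow> (LINT t|(lborel :: real measure). (0 :: real))"
    proof (rule integral_dominated_convergence)
      show "integrable lborel (\<lambda>t. indicator {y..} t *\<^sub>R E t)"
        using int unfolding set_integrable_def .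
      show "(\<lambda>t. indicator {Z n..} t *\<^sub>R E t) \<in> borel_measurable lborel" for n
        using int unfolding set_integrable_def by (rule borel_measurable_integrable)
      show "AE t in lborel. (\<lambda>n. indicator {Z n..} t *\<^sub>R E t) \<longlonglongrightarrow> 0"
      proof (intro AE_I2)
        fix t
        show "(\<lambda>n. indicator {Z n..} t *\<^sub>R E t) \<longlonglongrightarrow> 0"
        proof (cases "b \<le> ereal t")
          case False
          then have "\<forall>\<^sub>F n in sequentially. ereal t < ereal (Z n)"
            by (intro order_tendstoD(1)[OF Z(4)]) auto
          then have "\<forall>\<^sub>F n in sequentially. indicator {Z n..} t *\<^sub>R E t = 0"
            by eventually_elim auto
          then show ?thesis by (rule tendsto_eventually)
        qed (simp add: zero)
      qed
      show "AE t in lborel. norm (indicator {Z n..} t *\<^sub>R E t) \<le> indicator {y..} t *\<^sub>R E t" for n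
        using ZI(2)[of n] nonneg by (intro AE_I2) (auto simp: indicator_def)
    qed simp
    then show ?thesis by (simp add: P_def set_lebesgue_integral_def)
  qed
  \<comment> \<open>The index is chosen in two stages. \<open>Z m\<close> makes the tail integral
    small; then \<open>n\<close> is taken so large that \<open>(Z m - y) * E (Z n)\<close> is small.
    The remaining part \<open>(Z n - Z m) * E (Z n)\<close> is bounded by the tail from
    \<open>Z m\<close>.\<close>
  obtain m where m: "P (Z m) < e / 2"
    using order_tendstoD(2)[OF PZ, of "e / 2"] \<open>e > 0\<close> by (auto simp: eventually_sequentially)
  have "(\<lambda>n. (Z m - y) * E (Z n)) \<longlonglongrightarrow> (Z m - y) * 0"
    by (intro tendsto_intros EZ)
  then have "\<forall>\<^sub>F n in sequentially. (Z m - y) * E (Z n) < e / 2"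
    using \<open>e > 0\<close> by (intro order_tendstoD(2)) auto
  moreover have "\<forall>\<^sub>F n in sequentially. E (Z n) < e"
    using order_tendstoD(2)[OF EZ \<open>e > 0\<close>] .
  moreover have "\<forall>\<^sub>F n in sequentially. P (Z n) < e"
    using order_tendstoD(2)[OF PZ \<open>e > 0\<close>] .
  ultimately have "\<forall>\<^sub>F n in sequentially. (Z m - y) * E (Z n) < e / 2 \<and> E (Z n) < e \<and> P (Z n) < e \<and> n \<ge> m"
    using eventually_ge_at_top[of m] by eventually_elim auto
  then obtain n where n: "(Z m - y) * E (Z n) < e / 2" "E (Z n) < e" "P (Z n) < e" "n \<ge> m"
    by (auto simp: eventually_sequentially)
  have mn: "Z m \<le> Z n" using Z(1) n by (auto simp: incseq_def)
  have iE: "set_integrable lborel {Z m..<Z n} E"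
    by (rule set_integrable_subset[OF int[of "Z m"]]) (auto simp: subset_iff)
  have "E (Z n) * (Z n - Z m) \<le> (LINT t:{Z m..<Z n}|lborel. E t)"
    by (rule set_integral_bounds_Ico(2)[OF iE mn]) (use anti in \<open>auto simp: antimono_def\<close>)
  also have "\<dots> \<le> P (Z m)"
    using set_integral_split_Ici[OF int mn] set_integral_nonneg_Lebesgue[of "{Z n..}" E] nonneg by (simp add: P_def)
  finally have "(Z n - y) * E (Z n) < e"
    using n m by (simp add: algebra_simps)
  then show thesis
    using that[of "Z n"] ZI n by (auto simp: P_def)
qed

section \<open>Uniqueness for the integral equation of the cdf\<close>

text \<open>All probability has been removed: what remains are analytic properties of two cdfs and
  the formula for their common \<open>r\<close>.\<close>

lemma cdf_determined_by_max_regression: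
  fixes F G r :: "real \<Rightarrow> real" and a b :: ereal
  assumes mono: "mono F" "mono G" and cont: "continuous_on UNIV F" "continuous_on UNIV G"
    and lim: "(F \<longlongrightarrow> 1) at_top" "(G \<longlongrightarrow> 1) at_top"
    and range: "\<And>t. 0 \<le> F t" "\<And>t. 0 \<le> G t" "\<And>t. F t \<le> 1" "\<And>t. G t \<le> 1"
    and above: "\<And>t. b \<le> ereal t \<Longrightarrow> F t = 1" "\<And>t. b \<le> ereal t \<Longrightarrow> G t = 1"
    and below: "\<And>t. ereal t \<le> a \<Longrightarrow> F t = 0" "\<And>t. ereal t \<le> a \<Longrightarrow> G t = 0"
    and pos: "\<And>t. a < ereal t \<Longrightarrow> 0 < F t" "\<And>t. a < ereal t \<Longrightarrow> 0 < G t"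
    and int: "\<And>y. set_integrable lborel {y..} (\<lambda>t. 1 - F t)" "\<And>y. set_integrable lborel {y..} (\<lambda>t. 1 - G t)"
      "\<And>y. set_integrable lborel {..<y} (\<lambda>t. (F t)\<^sup>2)" "\<And>y. set_integrable lborel {..<y} (\<lambda>t. (G t)\<^sup>2)"
    and eqF: "\<And>y. y \<in> einterval a b \<Longrightarrow>
      2 * F y * r y = 2 * F y * (y + (LINT t:{y..}|lborel. 1 - F t)) - (LINT t:{..<y}|lborel. (F t)\<^sup>2)"
    and eqG: "\<And>y. y \<in> einterval a b \<Longrightarrow>
      2 * G y * r y = 2 * G y * (y + (LINT t:{y..}|lborel. 1 - G t)) - (LINT t:{..<y}|lborel. (G t)\<^sup>2)"
  shows "F = G"
proof -
  define D where "D = (\<lambda>t. F t - G t)"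
  define E where "E = (\<lambda>t. (1 - F t) + (1 - G t))"
  have E01: "0 \<le> E t" "E t \<le> 2" for t
    using range[of t] by (auto simp: E_def)
  have DE: "\<bar>D t\<bar> \<le> E t" for t
    using range[of t] by (auto simp: E_def D_def)
  have anti: "antimono E"
    using mono by (auto simp: mono_def antimono_def E_def add_mono diff_mono)
  have contE: "continuous_on UNIV E"
    unfolding E_def by (intro continuous_intros cont)
  have "((\<lambda>t. (1 - F t) + (1 - G t)) \<longlongrightarrow> (1 - 1) + (1 - 1)) at_top"
    by (intro tendsto_intros lim)
  then have limE: "(E \<longlongrightarrow> 0) at_top"
    by (simp add: E_def)
  have zeroE: "E t = 0" if "b \<le> ereal t" for t
    using above that by (simp add: E_def)
  have intE: "set_integrable lborel {y..} E" for y
    unfolding E_def by (intro set_integral_add int)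
  have intD: "set_integrable lborel {y..} D" for y
  proof -
    have "set_integrable lborel {y..} (\<lambda>t. (1 - G t) - (1 - F t))"
      by (intro set_integral_diff int)
    then show ?thesis by (simp add: D_def)
  qed
  have intD': "set_integrable lborel {y..} (\<lambda>t. \<bar>D t\<bar>)" for y
    by (rule set_integrable_abs[OF intD])
  define P where "P = (\<lambda>y. LINT t:{y..}|lborel. E t)"
  define \<Phi> where "\<Phi> = (\<lambda>y. LINT t:{y..}|lborel. \<bar>D t\<bar>)"
  define T where "T = (\<lambda>y. LINT t:{y..}|lborel. D t)"
  define KF where "KF = (\<lambda>y. LINT t:{..<y}|lborel. (F t)\<^sup>2)"
  define KG where "KG = (\<lambda>y. LINT t:{..<y}|lborel. (G t)\<^sup>2)"
  define J where "J = (\<lambda>y. LINT t:{y..}|lborel. (F t + G t) * D t)"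
  have \<Phi>_le: "\<Phi> y \<le> P y" for y
    unfolding \<Phi>_def P_def by (rule set_integral_mono[OF intD' intE DE])
  \<comment> \<open>Every integral against \<open>D\<close> below has a bounded weight
    \<open>f\<close>, so it is controlled by \<open>\<Phi>\<close>; this is used with weights
    \<open>1\<close>, \<open>F + G\<close> and the final kernel.\<close>
  have bd: "set_integrable lborel {y..} (\<lambda>t. f t * D t)" "\<bar>LINT t:{y..}|lborel. f t * D t\<bar> \<le> C * \<Phi> y"
    if [measurable]: "f \<in> borel_measurable borel" and C: "\<And>t. y \<le> t \<Longrightarrow> \<bar>f t\<bar> \<le> C" for f y C
  proof -
    have "C \<ge> 0" using C[of y] by auto
    have D [measurable]: "D \<in> borel_measurable borel"
      unfolding D_def by (intro borel_measurable_continuous_onI continuous_intros cont)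
    have ptw: "\<bar>f t * D t\<bar> \<le> C * \<bar>D t\<bar>" if "y \<le> t" for t
      using C[OF that] by (simp add: abs_mult mult_right_mono)
    have CD: "set_integrable lborel {y..} (\<lambda>t. C * \<bar>D t\<bar>)"
      using intD' by simp
    show i: "set_integrable lborel {y..} (\<lambda>t. f t * D t)"
      unfolding set_integrable_def
    proof (rule Bochner_Integration.integrable_bound[OF CD[unfolded set_integrable_def]])
      show "AE t in lborel. norm (indicator {y..} t *\<^sub>R (f t * D t)) \<le> norm (indicator {y..} t *\<^sub>R (C * \<bar>D t\<bar>))"
        using ptw \<open>C \<ge> 0\<close> by (intro AE_I2) (auto simp: indicator_def)
    qed measurable
    have "\<bar>LINT t:{y..}|lborel. f t * D t\<bar> \<le> (LINT t:{y..}|lborel. \<bar>f t * D t\<bar>)"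
      using set_integral_norm_bound[OF i] by simp
    also have "\<dots> \<le> (LINT t:{y..}|lborel. C * \<bar>D t\<bar>)"
      by (rule set_integral_mono[OF set_integrable_abs[OF i] CD]) (use ptw in auto)
    finally show "\<bar>LINT t:{y..}|lborel. f t * D t\<bar> \<le> C * \<Phi> y"
      by (simp add: \<Phi>_def)
  qed
  have meas [measurable]: "F \<in> borel_measurable borel" "G \<in> borel_measurable borel"
    by (intro borel_measurable_continuous_onI cont)+
  have FG: "\<bar>F t + G t\<bar> \<le> 2" for t
    using range[of t] by auto
  have intJ: "set_integrable lborel {y..} (\<lambda>t. (F t + G t) * D t)" for y
    by (rule bd(1)[OF _ FG]) measurable
  have J_le: "\<bar>J y\<bar> \<le> 2 * \<Phi> y" for y
    unfolding J_def by (rule bd(2)[OF _ FG]) measurable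
  have T_le: "\<bar>T y\<bar> \<le> \<Phi> y" for y
    using bd(2)[of "\<lambda>_. 1" y 1] by (simp add: T_def)
  \<comment> \<open>Cross-multiplying the two equations by \<open>G y\<close> and \<open>F y\<close>
    and subtracting eliminates \<open>r\<close>.\<close>
  have star: "KF y * G y - KG y * F y = - 2 * F y * G y * T y" if "y \<in> einterval a b" for y
  proof -
    have "T y = (LINT t:{y..}|lborel. (1 - G t) - (1 - F t))"
      by (simp add: T_def D_def)
    also have "\<dots> = (LINT t:{y..}|lborel. 1 - G t) - (LINT t:{y..}|lborel. 1 - F t)"
      by (intro set_integral_diff int)
    finally have T: "T y = (LINT t:{y..}|lborel. 1 - G t) - (LINT t:{y..}|lborel. 1 - F t)" .
    show ?thesis
      using arg_cong[OF eqF[OF that], of "\<lambda>x. x * G y"] arg_cong[OF eqG[OF that], of "\<lambda>x. x * F y"]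
      by (simp add: T KF_def KG_def algebra_simps)
  qed
  \<comment> \<open>Substitute \<open>F = G + D\<close> in the coefficient of \<open>KG\<close> and
    divide by \<open>G y\<close>.\<close>
  have star': "KF y - KG y = KG y * D y / G y - 2 * F y * T y" if "y \<in> einterval a b" for y
    using star[OF that] pos(2)[of y] that by (simp add: D_def einterval_def field_simps)
  \<comment> \<open>Since \<open>F\<^sup>2 - G\<^sup>2 = (F + G) * D\<close>, what
    \<open>KF - KG\<close> gains from \<open>y\<close> to \<open>z\<close> is exactly what
    \<open>J\<close> loses.\<close>
  have KJ_const: "KF z - KG z + J z = KF y - KG y + J y" if "y \<le> z" for y z
  proof -
    have i: "set_integrable lborel {y..<z} (\<lambda>t. (F t)\<^sup>2)" "set_integrable lborel {y..<z} (\<lambda>t. (G t)\<^sup>2)"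
      by (rule set_integrable_subset[OF int(3)[of z]] set_integrable_subset[OF int(4)[of z]]; auto)+
    have "KF z = KF y + (LINT t:{y..<z}|lborel. (F t)\<^sup>2)" "KG z = KG y + (LINT t:{y..<z}|lborel. (G t)\<^sup>2)"
      unfolding KF_def KG_def by (rule set_integral_split_Iio[OF _ that] int)+
    moreover have "J y = (LINT t:{y..<z}|lborel. (F t + G t) * D t) + J z"
      unfolding J_def by (rule set_integral_split_Ici[OF intJ that])
    moreover have "(LINT t:{y..<z}|lborel. (F t + G t) * D t) = (LINT t:{y..<z}|lborel. (F t)\<^sup>2 - (G t)\<^sup>2)"
      by (simp add: D_def power2_eq_square algebra_simps)
    moreover have "\<dots> = (LINT t:{y..<z}|lborel. (F t)\<^sup>2) - (LINT t:{y..<z}|lborel. (G t)\<^sup>2)"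
      by (rule set_integral_diff[OF i])
    ultimately show ?thesis by simp
  qed
  have KG_nonneg: "KG y \<ge> 0" for y
    unfolding KG_def by (rule set_integral_nonneg_Lebesgue) auto
  have KG_split: "KG z = KG y + (LINT t:{y..<z}|lborel. (G t)\<^sup>2)" if "y \<le> z" for y z
    unfolding KG_def by (rule set_integral_split_Iio[OF int(4) that])
  have intG2: "set_integrable lborel {y..<z} (\<lambda>t. (G t)\<^sup>2)" for y z
    by (rule set_integrable_subset[OF int(4)[of z]]; auto)
  have KG_growth: "KG z \<le> KG y + (z - y)" "KG y \<le> KG z" if "y \<le> z" for y z
  proof -
    have "(LINT t:{y..<z}|lborel. (G t)\<^sup>2) \<le> 1 * (z - y)"
      by (rule set_integral_bounds_Ico(1)[OF intG2 that]) (use range in \<open>auto intro: power_le_one\<close>)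
    then show "KG z \<le> KG y + (z - y)" using KG_split[OF that] by simp
    show "KG y \<le> KG z" using KG_split[OF that] set_integral_nonneg_Lebesgue[of "{y..<z}" "\<lambda>t. (G t)\<^sup>2"] by simp
  qed
  \<comment> \<open>The constant is evaluated near the upper end through \<open>star'\<close>. There
    \<open>KG z\<close> may grow like \<open>z - y\<close>, but it multiplies \<open>D z\<close>,
    and \<open>(z - y) * E z\<close> is small.\<close>
  have KJ: "KF y - KG y + J y = 0" if y: "y \<in> einterval a b" for y
  proof -
    have Gy: "G y > 0" using y pos by (simp add: einterval_def)
    \<comment> \<open>The 4 collects 2 from \<open>2 * F z * T z\<close> and 2 from
      \<open>J z\<close>; the fraction comes from \<open>KG z * D z / G z\<close>, using
      \<open>G y \<le> G z\<close>.\<close>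
    have "\<bar>KF y - KG y + J y\<bar> \<le> (4 + (KG y + 1) / G y) * e" if "e > 0" for e
    proof -
      obtain z where z: "z \<in> einterval a b" "y \<le> z" "P z < e" "E z < e" "(z - y) * E z < e"
        unfolding P_def by (rule exists_near_upper_end[OF y anti E01(1) contE limE zeroE intE \<open>e > 0\<close>])
      have "\<bar>KG z * D z / G z\<bar> = KG z * \<bar>D z\<bar> / G z"
        using KG_nonneg[of z] range(2)[of z] by (simp add: abs_mult)
      also have "\<dots> \<le> KG z * E z / G y"
        using mono(2) z(2) Gy KG_nonneg[of z] DE[of z] E01[of z]
        by (intro frac_le mult_left_mono) (auto simp: mono_def)
      also have "\<dots> \<le> (KG y * E z + (z - y) * E z) / G y"
        using mult_right_mono[OF KG_growth(1)[OF z(2)] E01(1)[of z]] Gy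
        by (intro divide_right_mono) (auto simp: algebra_simps)
      also have "\<dots> \<le> (KG y * e + e) / G y"
        using z Gy KG_nonneg[of y] by (intro divide_right_mono add_mono mult_left_mono) auto
      finally have 1: "\<bar>KG z * D z / G z\<bar> \<le> (KG y + 1) / G y * e"
        by (simp add: algebra_simps add_divide_distrib)
      have "\<bar>F z * T z\<bar> \<le> 1 * \<bar>T z\<bar>"
        unfolding abs_mult using range[of z] by (intro mult_right_mono) auto
      then have 2: "\<bar>2 * F z * T z\<bar> \<le> 2 * e"
        using T_le[of z] \<Phi>_le[of z] z(3) by (simp add: abs_mult)
      have 3: "\<bar>J z\<bar> \<le> 2 * e"
        using J_le[of z] \<Phi>_le[of z] z(3) by linarith
      have "\<bar>KF z - KG z + J z\<bar> \<le> \<bar>KG z * D z / G z\<bar> + \<bar>2 * F z * T z\<bar> + \<bar>J z\<bar>"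
        unfolding star'[OF z(1)] by linarith
      with 1 2 3 have "\<bar>KF z - KG z + J z\<bar> \<le> (4 + (KG y + 1) / G y) * e"
        by (simp add: distrib_right)
      then show ?thesis using KJ_const[OF z(2)] by simp
    qed note le = this
    have pos4: "4 + (KG y + 1) / G y > 0"
      using KG_nonneg[of y] Gy by (intro add_pos_nonneg) auto
    have "\<bar>KF y - KG y + J y\<bar> \<le> 0 + e" if "e > 0" for e
      using le[of "e / (4 + (KG y + 1) / G y)"] pos4 that by simp
    then have "\<bar>KF y - KG y + J y\<bar> \<le> 0"
      by (rule field_le_epsilon)
    then show ?thesis by simp
  qed
  \<comment> \<open>Combining \<open>star'\<close> and \<open>KJ\<close> writes
    \<open>KG y * D y / G y\<close> as one integral over \<open>{y..}\<close>. Its kernel is at most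
    \<open>F y - G y\<close> and at least \<open>- 2 * (1 - F y)\<close> by monotonicity, hence at
    most \<open>2 * E y\<close> in absolute value.\<close>
  have main: "KG y * \<bar>D y\<bar> \<le> 2 * E y * \<Phi> y" if y: "y \<in> einterval a b" for y
  proof -
    have Gy: "G y > 0" using y pos by (simp add: einterval_def)
    have iT: "set_integrable lborel {y..} (\<lambda>t. 2 * F y * D t)"
      using intD by simp
    have "KG y * D y / G y = 2 * F y * T y - J y"
      using star'[OF y] KJ[OF y] by simp
    also have "\<dots> = (LINT t:{y..}|lborel. 2 * F y * D t) - J y"
      by (simp add: T_def)
    also have "\<dots> = (LINT t:{y..}|lborel. 2 * F y * D t - (F t + G t) * D t)"
      unfolding J_def by (rule set_integral_diff(2)[OF iT intJ, symmetric])
    also have "\<dots> = (LINT t:{y..}|lborel. (2 * F y - F t - G t) * D t)"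
      by (simp add: algebra_simps)
    also have "\<bar>\<dots>\<bar> \<le> (2 * E y) * \<Phi> y"
    proof (rule bd(2))
      fix t assume "y \<le> t"
      then have "F y \<le> F t" "G y \<le> G t" using mono by (auto simp: mono_def)
      then show "\<bar>2 * F y - F t - G t\<bar> \<le> 2 * E y"
        using range[of t] range[of y] by (auto simp: E_def)
    qed measurable
    finally have "KG y * \<bar>D y\<bar> / G y \<le> 2 * E y * \<Phi> y"
      using KG_nonneg[of y] Gy by (simp add: abs_mult)
    then have "KG y * \<bar>D y\<bar> \<le> 2 * E y * \<Phi> y * G y"
      using Gy by (simp add: field_simps)
    also have "\<dots> \<le> 2 * E y * \<Phi> y * 1"
      using range(4)[of y] E01[of y] set_integral_nonneg_Lebesgue[of "{y..}" "\<lambda>t. \<bar>D t\<bar>"]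
      by (intro mult_left_mono) (auto simp: \<Phi>_def)
    finally show ?thesis by simp
  qed
  have inside: "D y0 = 0" if y0: "y0 \<in> einterval a b" for y0
  proof -
    \<comment> \<open>\<open>G\<close> is positive already at \<open>y'\<close>, so
      \<open>KG y0\<close> is bounded below by the mass of a nondegenerate interval.\<close>
    obtain y' where y': "a < ereal y'" "y' < y0"
      using y0 ereal_dense2[of a "ereal y0"] by (auto simp: einterval_def)
    have "0 < (G y')\<^sup>2 * (y0 - y')"
      using pos(2)[OF y'(1)] y' by simp
    also have "\<dots> \<le> (LINT t:{y'..<y0}|lborel. (G t)\<^sup>2)"
      by (rule set_integral_bounds_Ico(2)[OF intG2])
         (use y' mono range in \<open>auto intro!: power_mono simp: mono_def\<close>)
    also have "\<dots> \<le> KG y0"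
      using KG_split[of y' y0] KG_nonneg[of y'] y' by simp
    finally have KG0: "KG y0 > 0" .
    \<comment> \<open>\<open>KG\<close> is nondecreasing, so its value at \<open>y0\<close> yields
      one constant for all \<open>y \<ge> y0\<close>; beyond \<open>b\<close> both sides of the
      inequality vanish.\<close>
    define c where "c = 2 / KG y0"
    have c: "c > 0" using KG0 by (simp add: c_def)
    have le: "\<bar>D y\<bar> \<le> c * E y * (LINT t:{y..}|lborel. \<bar>D t\<bar>)" if "y0 \<le> y" for y
    proof (cases "ereal y < b")
      case True
      then have y: "y \<in> einterval a b"
        using y0 that by (auto simp: einterval_def intro: less_le_trans)
      have "KG y0 * \<bar>D y\<bar> \<le> KG y * \<bar>D y\<bar>"
        using KG_growth(2)[OF that] by (intro mult_right_mono) auto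
      also have "\<dots> \<le> 2 * E y * \<Phi> y" by (rule main[OF y])
      finally show ?thesis
        using KG0 by (simp add: c_def field_simps \<Phi>_def)
    next
      case False
      then have "D y = 0" "E y = 0" using above zeroE by (auto simp: D_def)
      then show ?thesis by simp
    qed
    obtain z where z: "y0 \<le> z" "P z < 1 / c"
      unfolding P_def by (rule exists_near_upper_end[OF y0 anti E01(1) contE limE zeroE intE, of "1 / c"]) (use c in auto)
    have "(LINT t:{y0..}|lborel. \<bar>D t\<bar>) = 0"
      by (rule tail_integral_eq_0[OF intD' intE E01 c le z(1) z(2)[unfolded P_def]])
    then show ?thesis using le[of y0] by simp
  qed
  show "F = G"
  proof
    fix t
    consider "ereal t \<le> a" | "b \<le> ereal t" | "t \<in> einterval a b"
      by (force simp: einterval_def)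
    then show "F t = G t"
      by cases (use above below inside in \<open>auto simp: D_def\<close>)
  qed
qed

section \<open>Cdfs with interval support and reflection\<close>

text \<open>Absolute continuity excludes atoms, hence jumps. Monotonicity carries the boundary
  values outward from finite end points, and comparison with a smaller point of the interval gives
  positivity.\<close>

lemma cdf_interval_support:
  assumes ac: "abs_cont_distribution \<mu>" and supp: "interval_support \<mu> a b" and ab: "a < b"
  shows "real_distribution \<mu>" and "continuous_on UNIV (cdf \<mu>)" and "measure \<mu> {x} = 0"
    and "ereal t \<le> a \<Longrightarrow> cdf \<mu> t = 0" and "b \<le> ereal t \<Longrightarrow> cdf \<mu> t = 1" and "a < ereal t \<Longrightarrow> 0 < cdf \<mu> t"
proof -
  show rd: "real_distribution \<mu>"
    using ac by (simp add: abs_cont_distribution_def)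
  then interpret real_distribution \<mu> .
  have atom: "measure \<mu> {x} = 0" for x
  proof -
    have "{x} \<in> null_sets lborel" by (simp add: null_sets_def)
    then have "{x} \<in> null_sets \<mu>"
      using ac by (auto simp: abs_cont_distribution_def absolutely_continuous_def)
    then show ?thesis by (simp add: null_sets_def measure_def)
  qed
  show "measure \<mu> {x} = 0" by (rule atom)
  show "continuous_on UNIV (cdf \<mu>)"
    by (intro continuous_at_imp_continuous_on ballI) (simp add: isCont_cdf atom)
  show "cdf \<mu> t = 0" if "ereal t \<le> a"
  proof (cases a)
    case (real a')
    then show ?thesis
      using supp that cdf_nondecreasing[of t a'] cdf_nonneg[of t] by (auto simp: interval_support_def)
  qed (use that ab in auto)
  have above: "cdf \<mu> t = 1" if "b \<le> ereal t" for t
  proof (cases b)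
    case (real b')
    then show ?thesis
      using supp that cdf_nondecreasing[of b' t] cdf_bounded_prob[of t] by (auto simp: interval_support_def)
  qed (use that ab in auto)
  then show "b \<le> ereal t \<Longrightarrow> cdf \<mu> t = 1" .
  show "0 < cdf \<mu> t" if at: "a < ereal t"
  proof (cases "ereal t < b")
    case True
    obtain s where s: "a < ereal s" "s < t"
      using ereal_dense2[OF at] by auto
    have "ereal s < b"
      using s(2) True less_trans[of "ereal s" "ereal t" b] by simp
    then have "s \<in> einterval a b" "t \<in> einterval a b"
      using s True at by (auto simp: einterval_def)
    then have "cdf \<mu> s < cdf \<mu> t"
      using supp s by (auto simp: interval_support_def intro: strict_mono_onD)
    then show ?thesis using cdf_nonneg[of s] by simp
  qed (use above in auto)
qed

text \<open>The reflected half-line is complementary to the open \<open>{..< - x}\<close>; absence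
  of atoms makes its mass equal to that of the closed one.\<close>

lemma cdf_distr_uminus:
  assumes "real_distribution \<mu>" and "\<And>x. measure \<mu> {x} = 0"
  shows "cdf (distr \<mu> borel uminus) x = 1 - cdf \<mu> (- x)"
proof -
  interpret real_distribution \<mu> by fact
  have "cdf (distr \<mu> borel uminus) x = measure \<mu> (uminus -` {..x} \<inter> space \<mu>)"
    unfolding cdf_def by (rule measure_distr) auto
  also have "uminus -` {..x} \<inter> space \<mu> = space \<mu> - {..< - x}"
    by auto
  also have "measure \<mu> \<dots> = 1 - measure \<mu> {..< - x}"
    by (rule prob_compl) simp
  also have "measure \<mu> {..< - x} = cdf \<mu> (- x)"
  proof -
    have "{.. - x} = {..< - x} \<union> {- x}" by auto
    then have "cdf \<mu> (- x) = measure \<mu> {..< - x} + measure \<mu> {- x}"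
      unfolding cdf_def by (simp only:) (rule finite_measure_Union, auto)
    then show ?thesis using assms(2)[of "- x"] by simp
  qed
  finally show ?thesis .
qed

lemma uminus_mem_einterval_iff: "- x \<in> einterval a b \<longleftrightarrow> x \<in> einterval (- b) (- a)"
  by (auto simp: einterval_def ereal_uminus_less_reorder ereal_less_uminus_reorder simp flip: uminus_ereal.simps)

lemma abs_cont_distribution_uminus:
  assumes "abs_cont_distribution \<mu>"
  shows "abs_cont_distribution (distr \<mu> borel uminus)"
proof -
  interpret real_distribution \<mu>
    using assms by (simp add: abs_cont_distribution_def)
  have "A \<in> null_sets (distr \<mu> borel uminus)" if A: "A \<in> null_sets lborel" for A
  proof -
    have "A \<in> null_sets (distr lborel borel uminus)"
      using A by (simp add: lborel_distr_uminus)
    then have "uminus -` A \<in> null_sets lborel" "A \<in> sets borel"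
      by (auto simp: null_sets_distr_iff)
    then have "uminus -` A \<in> null_sets \<mu>"
      using assms by (auto simp: abs_cont_distribution_def absolutely_continuous_def)
    with \<open>A \<in> sets borel\<close> show ?thesis
      by (subst null_sets_distr_iff) (auto simp: space_eq_univ)
  qed
  moreover have "real_distribution (distr \<mu> borel uminus)"
    by (rule real_distribution_distr) simp
  ultimately show ?thesis
    by (auto simp: abs_cont_distribution_def absolutely_continuous_def)
qed

lemma interval_support_uminus:
  assumes ac: "abs_cont_distribution \<mu>" and supp: "interval_support \<mu> a b" and ab: "a < b"
  shows "interval_support (distr \<mu> borel uminus) (- b) (- a)"
proof -
  note * = cdf_interval_support[OF assms]
  note cdf = cdf_distr_uminus[OF *(1,3)]
  have "strict_mono_on (einterval (- b) (- a)) (cdf (distr \<mu> borel uminus))"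
  proof (rule strict_mono_onI)
    fix s t assume "s \<in> einterval (- b) (- a)" "t \<in> einterval (- b) (- a)" "s < t"
    then show "cdf (distr \<mu> borel uminus) s < cdf (distr \<mu> borel uminus) t"
      unfolding cdf uminus_mem_einterval_iff[symmetric]
      using supp strict_mono_onD[of "einterval a b" "cdf \<mu>" "- t" "- s"]
      by (simp add: interval_support_def)
  qed
  moreover have "ereal x = - b \<Longrightarrow> b = ereal (- x)" "ereal x = - a \<Longrightarrow> a = ereal (- x)" for x
    by (metis ereal_uminus_uminus uminus_ereal.simps(1))+
  ultimately show ?thesis
    unfolding interval_support_def cdf using *(4,5) by auto
qed

lemma iid_triple_uminus:
  assumes "iid_triple M \<mu> X"
  shows "iid_triple M (distr \<mu> borel uminus) (\<lambda>i \<omega>. - X i \<omega>)"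
proof -
  interpret prob_space M using assms by (simp add: iid_triple_def)
  have ind: "indep_vars (\<lambda>_. borel) X {1, 2, 3}"
    using assms by (simp add: iid_triple_def)
  have "indep_vars (\<lambda>_. borel) (\<lambda>i \<omega>. - X i \<omega>) {1, 2, 3}"
    by (rule indep_vars_compose2[OF ind, where Y="\<lambda>_. uminus"]) auto
  moreover have "distr M borel (\<lambda>\<omega>. - X i \<omega>) = distr \<mu> borel uminus" if i: "i \<in> {1, 2, 3}" for i
  proof -
    have "X i \<in> borel_measurable M" using ind i unfolding indep_vars_def by auto
    then have "distr (distr M borel (X i)) borel uminus = distr M borel (uminus \<circ> X i)"
      by (intro distr_distr) auto
    then show ?thesis using assms i by (auto simp: iid_triple_def comp_def)
  qed
  ultimately show ?thesis
    using prob_space_axioms by (auto simp: iid_triple_def)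
qed

text \<open>Testing against Borel subsets of \<open>I\<close> replaces the conditional expectation, because this
  form is visibly invariant under the reflection that turns minima into maxima.\<close>

definition tested_regression ::
  "'a measure \<Rightarrow> ('a \<Rightarrow> real) \<Rightarrow> ('a \<Rightarrow> real) \<Rightarrow> real set \<Rightarrow> (real \<Rightarrow> real) \<Rightarrow> bool" where
  "tested_regression M U V I r \<longleftrightarrow> continuous_on I r \<and>
     (\<forall>S\<in>sets borel. S \<subseteq> I \<longrightarrow>
        (\<integral>\<omega>. indicator S (V \<omega>) * U \<omega> \<partial>M) = (\<integral>\<omega>. indicator S (V \<omega>) * r (V \<omega>) \<partial>M))"

lemma (in prob_space) tested_regressionI:
  assumes "continuous_regression M U V I r" "integrable M U" "V \<in> borel_measurable M"
  shows "tested_regression M U V I r"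
proof -
  have "continuous_on I r"
    using assms(1) by (simp add: continuous_regression_def)
  then show ?thesis
    unfolding tested_regression_def by (intro conjI ballI impI regression_integral[OF assms])
qed

lemma tested_regression_uminus:
  assumes "tested_regression M U V (einterval a b) r"
  shows "tested_regression M (\<lambda>\<omega>. - U \<omega>) (\<lambda>\<omega>. - V \<omega>) (einterval (- b) (- a)) (\<lambda>y. - r (- y))"
proof -
  have r: "continuous_on (einterval a b) r"
    using assms by (simp add: tested_regression_def)
  have "uminus ` einterval (- b) (- a) \<subseteq> einterval a b"
    by (rule image_subsetI) (simp add: uminus_mem_einterval_iff)
  then have "continuous_on (einterval (- b) (- a)) (\<lambda>y. - r (- y))"
    by (rule continuous_on_minus[OF continuous_on_compose2[OF r continuous_on_minus[OF continuous_on_id]]])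
  moreover have "(\<integral>\<omega>. indicator S (- V \<omega>) * (- U \<omega>) \<partial>M) =
      (\<integral>\<omega>. indicator S (- V \<omega>) * (- r (- (- V \<omega>))) \<partial>M)"
    if S: "S \<in> sets borel" "S \<subseteq> einterval (- b) (- a)" for S
  proof -
    have "uminus -` S \<in> sets borel"
      using measurable_sets[of uminus borel borel S] S by simp
    moreover have "uminus -` S \<subseteq> einterval a b"
    proof
      fix x assume "x \<in> uminus -` S"
      then have "- x \<in> einterval (- b) (- a)" using S(2) by auto
      then show "x \<in> einterval a b" by (simp flip: uminus_mem_einterval_iff)
    qed
    ultimately have "(\<integral>\<omega>. indicator (uminus -` S) (V \<omega>) * U \<omega> \<partial>M) =
        (\<integral>\<omega>. indicator (uminus -` S) (V \<omega>) * r (V \<omega>) \<partial>M)"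
      using assms by (simp add: tested_regression_def)
    moreover have "indicator (uminus -` S) x = (indicator S (- x) :: real)" for x
      by (simp add: indicator_def)
    ultimately show ?thesis by simp
  qed
  ultimately show ?thesis
    unfolding tested_regression_def by blast
qed

section \<open>From equal regressions to equal cdfs\<close>

lemma cdf_formulas_max_regression:
  assumes ac: "abs_cont_distribution \<mu>" and supp: "interval_support \<mu> a b" and ab: "a < b"
    and iid: "iid_triple M \<mu> X" and int: "integrable M (\<lambda>\<omega>. max (X 1 \<omega>) (X 2 \<omega>))"
    and reg: "tested_regression M (\<lambda>\<omega>. max (X 1 \<omega>) (X 2 \<omega>)) (\<lambda>\<omega>. max (X 2 \<omega>) (X 3 \<omega>)) (einterval a b) r"
  defines "F \<equiv> cdf \<mu>"
  shows "set_integrable lborel {y..} (\<lambda>t. 1 - F t)"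
    and "set_integrable lborel {..<y} (\<lambda>t. (F t)\<^sup>2)"
    and "y \<in> einterval a b \<Longrightarrow>
      2 * F y * r y = 2 * F y * (y + (LINT t:{y..}|lborel. 1 - F t)) - (LINT t:{..<y}|lborel. (F t)\<^sup>2)"
proof -
  interpret M: prob_space M using iid by (simp add: iid_triple_def)
  have ind: "M.indep_vars (\<lambda>_. borel) X {1, 2, 3}"
    using iid by (simp add: iid_triple_def)
  have F: "M.prob {\<omega> \<in> space M. X i \<omega> \<le> t} = F t" if i: "i \<in> {1, 2, 3}" for i t
  proof -
    have X: "X i \<in> borel_measurable M" using ind i unfolding M.indep_vars_def by auto
    have "F t = measure (distr M borel (X i)) {..t}"
      using iid i by (auto simp: F_def cdf_def iid_triple_def)
    also have "\<dots> = M.prob (X i -` {..t} \<inter> space M)"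
      by (rule measure_distr[OF X]) simp
    also have "X i -` {..t} \<inter> space M = {\<omega> \<in> space M. X i \<omega> \<le> t}"
      by auto
    finally show ?thesis ..
  qed
  have sm: "strict_mono_on (einterval a b) F"
    using supp by (simp add: F_def interval_support_def)
  have r: "continuous_on (einterval a b) r"
    using reg by (simp add: tested_regression_def)
  note formula = M.regression_max_formula[OF ind F cdf_interval_support(2)[OF ac supp ab, folded F_def] int
      open_einterval sm r]
  show "set_integrable lborel {y..} (\<lambda>t. 1 - F t)" "set_integrable lborel {..<y} (\<lambda>t. (F t)\<^sup>2)"
    "y \<in> einterval a b \<Longrightarrow>
      2 * F y * r y = 2 * F y * (y + (LINT t:{y..}|lborel. 1 - F t)) - (LINT t:{..<y}|lborel. (F t)\<^sup>2)"
    by (rule formula; use reg in \<open>simp add: tested_regression_def\<close>)+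
qed

lemma cdf_eq_if_max_regression_eq:
  assumes ab: "a < b"
    and \<mu>: "abs_cont_distribution \<mu>" "interval_support \<mu> a b"
    and \<nu>: "abs_cont_distribution \<nu>" "interval_support \<nu> a b"
    and X: "iid_triple M \<mu> X" "integrable M (\<lambda>\<omega>. max (X 1 \<omega>) (X 2 \<omega>))"
      "tested_regression M (\<lambda>\<omega>. max (X 1 \<omega>) (X 2 \<omega>)) (\<lambda>\<omega>. max (X 2 \<omega>) (X 3 \<omega>)) (einterval a b) r"
    and Y: "iid_triple N \<nu> Y" "integrable N (\<lambda>\<omega>. max (Y 1 \<omega>) (Y 2 \<omega>))"
      "tested_regression N (\<lambda>\<omega>. max (Y 1 \<omega>) (Y 2 \<omega>)) (\<lambda>\<omega>. max (Y 2 \<omega>) (Y 3 \<omega>)) (einterval a b) r"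
  shows "cdf \<mu> = cdf \<nu>"
proof -
  note m = cdf_interval_support[OF \<mu> ab] and n = cdf_interval_support[OF \<nu> ab]
  interpret \<mu>: real_distribution \<mu> by (rule m)
  interpret \<nu>: real_distribution \<nu> by (rule n)
  note fm = cdf_formulas_max_regression[OF \<mu> ab X] and fn = cdf_formulas_max_regression[OF \<nu> ab Y]
  show ?thesis
    by (rule cdf_determined_by_max_regression[OF _ _ m(2) n(2) \<mu>.cdf_lim_at_top_prob \<nu>.cdf_lim_at_top_prob
          \<mu>.cdf_nonneg \<nu>.cdf_nonneg \<mu>.cdf_bounded_prob \<nu>.cdf_bounded_prob m(5) n(5) m(4) n(4) m(6) n(6)
          fm(1) fn(1) fm(2) fn(2) fm(3) fn(3)])
       (auto intro: monoI \<mu>.cdf_nondecreasing \<nu>.cdf_nondecreasing)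
qed

text \<open>The result for maxima is applied to the negated samples, which live on the interval from
  \<open>- b\<close> to \<open>- a\<close> and have the regression function
  \<open>- r (- y)\<close>.\<close>

lemma cdf_eq_if_min_regression_eq:
  assumes ab: "a < b"
    and \<mu>: "abs_cont_distribution \<mu>" "interval_support \<mu> a b"
    and \<nu>: "abs_cont_distribution \<nu>" "interval_support \<nu> a b"
    and X: "iid_triple M \<mu> X" "integrable M (\<lambda>\<omega>. min (X 1 \<omega>) (X 2 \<omega>))"
      "tested_regression M (\<lambda>\<omega>. min (X 1 \<omega>) (X 2 \<omega>)) (\<lambda>\<omega>. min (X 2 \<omega>) (X 3 \<omega>)) (einterval a b) r"
    and Y: "iid_triple N \<nu> Y" "integrable N (\<lambda>\<omega>. min (Y 1 \<omega>) (Y 2 \<omega>))"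
      "tested_regression N (\<lambda>\<omega>. min (Y 1 \<omega>) (Y 2 \<omega>)) (\<lambda>\<omega>. min (Y 2 \<omega>) (Y 3 \<omega>)) (einterval a b) r"
  shows "cdf \<mu> = cdf \<nu>"
proof -
  have max_uminus: "max (- x) (- y) = - min x y" for x y :: real
    by auto
  have "cdf (distr \<mu> borel uminus) = cdf (distr \<nu> borel uminus)"
  proof (rule cdf_eq_if_max_regression_eq)
    show "- b < - a" using ab by simp
    show "abs_cont_distribution (distr \<mu> borel uminus)" "abs_cont_distribution (distr \<nu> borel uminus)"
      by (intro abs_cont_distribution_uminus \<mu> \<nu>)+
    show "interval_support (distr \<mu> borel uminus) (- b) (- a)" "interval_support (distr \<nu> borel uminus) (- b) (- a)"
      by (intro interval_support_uminus \<mu> \<nu> ab)+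
    show "iid_triple M (distr \<mu> borel uminus) (\<lambda>i \<omega>. - X i \<omega>)" "iid_triple N (distr \<nu> borel uminus) (\<lambda>i \<omega>. - Y i \<omega>)"
      by (intro iid_triple_uminus X Y)+
    show "integrable M (\<lambda>\<omega>. max (- X 1 \<omega>) (- X 2 \<omega>))" "integrable N (\<lambda>\<omega>. max (- Y 1 \<omega>) (- Y 2 \<omega>))"
      unfolding max_uminus using X(2) Y(2) by simp_all
    show "tested_regression M (\<lambda>\<omega>. max (- X 1 \<omega>) (- X 2 \<omega>)) (\<lambda>\<omega>. max (- X 2 \<omega>) (- X 3 \<omega>)) (einterval (- b) (- a)) (\<lambda>y. - r (- y))"
      "tested_regression N (\<lambda>\<omega>. max (- Y 1 \<omega>) (- Y 2 \<omega>)) (\<lambda>\<omega>. max (- Y 2 \<omega>) (- Y 3 \<omega>)) (einterval (- b) (- a)) (\<lambda>y. - r (- y))"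
      unfolding max_uminus by (intro tested_regression_uminus X Y)+
  qed
  \<comment> \<open>Evaluating the reflected cdfs at \<open>- x\<close> undoes the
    reflection.\<close>
  from fun_cong[OF this, of "- x" for x] show ?thesis
    using cdf_distr_uminus[OF cdf_interval_support(1,3)[OF \<mu> ab]] cdf_distr_uminus[OF cdf_interval_support(1,3)[OF \<nu> ab]]
    by (simp add: fun_eq_iff)
qed

theorem theorem3p1:
  fixes M :: "'a measure" and N :: "'b measure"
    and \<mu> \<nu> :: "real measure"
    and X :: "nat \<Rightarrow> 'a \<Rightarrow> real" and Y :: "nat \<Rightarrow> 'b \<Rightarrow> real"
    and a b :: ereal
  assumes "a < b"
    and "abs_cont_distribution \<mu>" and "interval_support \<mu> a b"
    and "abs_cont_distribution \<nu>" and "interval_support \<nu> a b"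
    and "iid_triple M \<mu> X" and "iid_triple N \<nu> Y"
  shows
    "(\<forall>r. integrable M (\<lambda>\<omega>. max (X 1 \<omega>) (X 2 \<omega>)) \<longrightarrow>
          integrable N (\<lambda>\<omega>. max (Y 1 \<omega>) (Y 2 \<omega>)) \<longrightarrow>
          continuous_regression M (\<lambda>\<omega>. max (X 1 \<omega>) (X 2 \<omega>)) (\<lambda>\<omega>. max (X 2 \<omega>) (X 3 \<omega>))
            (einterval a b) r \<longrightarrow>
          continuous_regression N (\<lambda>\<omega>. max (Y 1 \<omega>) (Y 2 \<omega>)) (\<lambda>\<omega>. max (Y 2 \<omega>) (Y 3 \<omega>))
            (einterval a b) r \<longrightarrow>
          (einterval a b \<noteq> UNIV \<longrightarrow> cdf \<mu> = cdf \<nu>) \<and>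
          (einterval a b = UNIV \<longrightarrow> (\<exists>c. \<forall>y. cdf \<nu> y = cdf \<mu> (y + c)))) \<and>
     (\<forall>r. integrable M (\<lambda>\<omega>. min (X 1 \<omega>) (X 2 \<omega>)) \<longrightarrow>
          integrable N (\<lambda>\<omega>. min (Y 1 \<omega>) (Y 2 \<omega>)) \<longrightarrow>
          continuous_regression M (\<lambda>\<omega>. min (X 1 \<omega>) (X 2 \<omega>)) (\<lambda>\<omega>. min (X 2 \<omega>) (X 3 \<omega>))
            (einterval a b) r \<longrightarrow>
          continuous_regression N (\<lambda>\<omega>. min (Y 1 \<omega>) (Y 2 \<omega>)) (\<lambda>\<omega>. min (Y 2 \<omega>) (Y 3 \<omega>))
            (einterval a b) r \<longrightarrow>
          (einterval a b \<noteq> UNIV \<longrightarrow> cdf \<mu> = cdf \<nu>) \<and>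
          (einterval a b = UNIV \<longrightarrow> (\<exists>c. \<forall>y. cdf \<nu> y = cdf \<mu> (y + c))))"
proof -
  interpret M: prob_space M using assms(6) by (simp add: iid_triple_def)
  interpret N: prob_space N using assms(7) by (simp add: iid_triple_def)
  have X: "X i \<in> borel_measurable M" if "i \<in> {1, 2, 3}" for i
    using assms(6) that unfolding iid_triple_def M.indep_vars_def by auto
  have Y: "Y i \<in> borel_measurable N" if "i \<in> {1, 2, 3}" for i
    using assms(7) that unfolding iid_triple_def N.indep_vars_def by auto
  have meas:
    "(\<lambda>\<omega>. max (X 2 \<omega>) (X 3 \<omega>)) \<in> borel_measurable M" "(\<lambda>\<omega>. min (X 2 \<omega>) (X 3 \<omega>)) \<in> borel_measurable M"
    "(\<lambda>\<omega>. max (Y 2 \<omega>) (Y 3 \<omega>)) \<in> borel_measurable N" "(\<lambda>\<omega>. min (Y 2 \<omega>) (Y 3 \<omega>)) \<in> borel_measurable N"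
    using X Y by (auto intro: borel_measurable_max borel_measurable_min)
  \<comment> \<open>Equality of the cdfs settles both cases; on the whole line the witness is the
    shift 0.\<close>
  have shift: "(einterval a b \<noteq> UNIV \<longrightarrow> cdf \<mu> = cdf \<nu>) \<and>
      (einterval a b = UNIV \<longrightarrow> (\<exists>c. \<forall>y. cdf \<nu> y = cdf \<mu> (y + c)))" if "cdf \<mu> = cdf \<nu>"
    using that by (auto intro!: exI[of _ 0])
  show ?thesis
  proof (intro conjI[OF allI allI] impI shift)
    fix r
    assume int: "integrable M (\<lambda>\<omega>. max (X 1 \<omega>) (X 2 \<omega>))" "integrable N (\<lambda>\<omega>. max (Y 1 \<omega>) (Y 2 \<omega>))"
      and reg: "continuous_regression M (\<lambda>\<omega>. max (X 1 \<omega>) (X 2 \<omega>)) (\<lambda>\<omega>. max (X 2 \<omega>) (X 3 \<omega>)) (einterval a b) r"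
        "continuous_regression N (\<lambda>\<omega>. max (Y 1 \<omega>) (Y 2 \<omega>)) (\<lambda>\<omega>. max (Y 2 \<omega>) (Y 3 \<omega>)) (einterval a b) r"
    show "cdf \<mu> = cdf \<nu>"
      using cdf_eq_if_max_regression_eq[OF assms(1-6) int(1) M.tested_regressionI[OF reg(1) int(1) meas(1)]
          assms(7) int(2) N.tested_regressionI[OF reg(2) int(2) meas(3)]] .
  next
    fix r
    assume int: "integrable M (\<lambda>\<omega>. min (X 1 \<omega>) (X 2 \<omega>))" "integrable N (\<lambda>\<omega>. min (Y 1 \<omega>) (Y 2 \<omega>))"
      and reg: "continuous_regression M (\<lambda>\<omega>. min (X 1 \<omega>) (X 2 \<omega>)) (\<lambda>\<omega>. min (X 2 \<omega>) (X 3 \<omega>)) (einterval a b) r"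
        "continuous_regression N (\<lambda>\<omega>. min (Y 1 \<omega>) (Y 2 \<omega>)) (\<lambda>\<omega>. min (Y 2 \<omega>) (Y 3 \<omega>)) (einterval a b) r"
    show "cdf \<mu> = cdf \<nu>"
      using cdf_eq_if_min_regression_eq[OF assms(1-6) int(1) M.tested_regressionI[OF reg(1) int(1) meas(2)]
          assms(7) int(2) N.tested_regressionI[OF reg(2) int(2) meas(4)]] .
  qed
qed

end
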